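(* Let $(X,Y,\mu)$ be an integrable $(G,H)$-transverse system with $H$-transverse measure $\sigma$. (i) There are well-defined linear operators $S:C_c(H\backslash G)\to L^1(X,\mu)$ and $S^*:L^\infty(X,\mu)\to L^\infty(H\backslash G)$ given by $$Sf(x)=\sum_{Hg\in Y_x}f(Hg),\qquad S^*\phi(Hg)=\int_Y\phi(g^{-1}.y)\,d\sigma(y).$$ (ii) $S$ and $S^*$ are formally adjoint: for all $f\in C_c(H\backslash G)$ and $\phi\in L^\infty(X,\mu)$, $$\int_X Sf\cdot\overline{\phi}\,d\mu=\int_{H\backslash G}f\cdot\overline{S^*\phi}\,dm_{H\backslash G}.$$
   Context: $G$ is a unimodular lcsc group and $H<G$ a closed unimodular subgroup, with Haar measures $m_G,m_H$ and the $G$-invariant measure $m_{H\backslash G}$ on $H\backslash G$ normalized by $\int_G f\,dm_G=\int_{H\backslash G}\int_H f(hg)\,dm_H(h)\,dm_{H\backslash G}(Hg)$ for $f\in C_c(G)$. $X$ is a standard Borel $G$-space. A $(G,H)$-cross section is a Borel subset $Y\subset X$ with $G.Y=X$ and $H.Y=Y$; its hitting time sets are $Y_x=\{Hg\in H\backslash G\mid g.x\in Y\}$. If $\mu$ is a $G$-invariant Borel probability measure on $X$, then $(X,Y,\mu)$ is a $(G,H)$-transverse system; it is integrable if $\int_X|Y_x\cap L|\,d\mu(x)<\infty$ for every compact $L\subset H\backslash G$. The $H$-transverse measure $\sigma$ is the unique finite $H$-invariant Borel measure on $Y$ such that $$\int_X\sum_{Hg\in Y_x}\int_H F((hg)^{-1},hg.x)\,dm_H(h)\,d\mu(x)=\int_G\int_Y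 F(g,y)\,d\sigma(y)\,dm_G(g)$$ for all bounded Borel $F:G\times Y\to\mathbb C$ vanishing outside $L\times Y$ for some compact $L\subset G$. (Equivalently, $S$ and $S^*$ are pullback followed by fiber integration in the double fibration $H\backslash G\leftarrow\widetilde X\to X$, $\widetilde X=\{(Hg,x)\mid Hg\in Y_x\}$, with fiber measures counting measure on $Y_x$ and $\sigma$ on $Y\cong\{Hg\}\times g^{-1}.Y$.) *)

theory Defs
  imports "HOL-Probability.Probability_Measure" "HOL-Algebra.Group_Action"
begin

section \<open>Borel structures and function spaces\<close>

definition borel_of :: "'a topology \<Rightarrow> 'a measure" where
  "borel_of T = sigma (topspace T) {U. openin T U}"

text \<open>Only the underlying measurable space of \<open>M\<close> matters here.\<close>

definition standard_borel :: "'a measure \<Rightarrow> bool" where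
  "standard_borel M \<longleftrightarrow>
     (\<exists>T. completely_metrizable_space T \<and> second_countable T \<and>
          topspace T = space M \<and> sets M = sets (borel_of T))"

definition Cc :: "'a topology \<Rightarrow> ('a \<Rightarrow> complex) set" where
  "Cc T = {f. continuous_map T euclidean f \<and>
              compactin T (T closure_of {x \<in> topspace T. f x \<noteq> 0})}"

text \<open>
  The spaces \<open>L\<^sup>1(M)\<close> and \<open>L\<^sup>\<infinity>(M)\<close> are represented by functions, to be identified when they agree
  almost everywhere. ``Measurable'' means measurable for the completed sigma-algebra; since every
  such function agrees almost everywhere with a Borel one, the quotient spaces are the usual ones.
  The completion is needed because a sum over the hitting times of \<open>x\<close> is in general only
  universally measurable in \<open>x\<close>, not Borel.
\<close>

definition L1_space :: "'a measure \<Rightarrow> ('a \<Rightarrow> complex) set" where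
  "L1_space M = {f. integrable (completion M) f}"

definition Linf_space :: "'a measure \<Rightarrow> ('a \<Rightarrow> complex) set" where
  "Linf_space M = {f \<in> borel_measurable (completion M). \<exists>C. AE x in M. norm (f x) \<le> C}"

definition ae_eq :: "'a measure \<Rightarrow> ('a \<Rightarrow> complex) \<Rightarrow> ('a \<Rightarrow> complex) \<Rightarrow> bool" where
  "ae_eq M f g \<longleftrightarrow> (AE x in M. f x = g x)"

definition eq_on :: "'a set \<Rightarrow> ('a \<Rightarrow> complex) \<Rightarrow> ('a \<Rightarrow> complex) \<Rightarrow> bool" where
  "eq_on A f g \<longleftrightarrow> (\<forall>x\<in>A. f x = g x)"

text \<open>
  \<open>T\<close> induces a well-defined complex-linear map from the space \<open>V\<close> modulo \<open>E\<close> to the space \<open>W\<close>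
  modulo \<open>E'\<close>.
\<close>

definition linear_operator_mod ::
  "('a \<Rightarrow> complex) set \<Rightarrow> (('a \<Rightarrow> complex) \<Rightarrow> ('a \<Rightarrow> complex) \<Rightarrow> bool) \<Rightarrow>
   ('b \<Rightarrow> complex) set \<Rightarrow> (('b \<Rightarrow> complex) \<Rightarrow> ('b \<Rightarrow> complex) \<Rightarrow> bool) \<Rightarrow>
   (('a \<Rightarrow> complex) \<Rightarrow> 'b \<Rightarrow> complex) \<Rightarrow> bool" where
  "linear_operator_mod V E W E' T \<longleftrightarrow>
     (\<forall>f\<in>V. T f \<in> W) \<and>
     (\<forall>f\<in>V. \<forall>g\<in>V. E f g \<longrightarrow> E' (T f) (T g)) \<and>
     (\<forall>f\<in>V. \<forall>g\<in>V. E' (T (\<lambda>x. f x + g x)) (\<lambda>y. T f y + T g y)) \<and>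
     (\<forall>a. \<forall>f\<in>V. E' (T (\<lambda>x. a * f x)) (\<lambda>y. a * T f y))"

section \<open>Locally compact second countable groups\<close>

locale lcsc_group = group G
  for G :: "('g::{t2_space, second_countable_topology}, 'b) monoid_scheme" (structure) +
  assumes carrier_UNIV: "carrier G = UNIV"
    and continuous_mult: "continuous_on UNIV (\<lambda>p. fst p \<otimes> snd p)"
    and continuous_inv: "continuous_on UNIV (\<lambda>g. inv g)"
    and locally_compact: "locally_compact_space (euclidean :: 'g topology)"

text \<open>
  The following is meant for the group itself and, via \<open>G\<lparr>carrier := H\<rparr>\<close>, for its closed subgroups.
  Regularity is automatic by second countability.
\<close>

definition left_haar_measure ::
  "('g::topological_space, 'b) monoid_scheme \<Rightarrow> 'g measure \<Rightarrow> bool" where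
  "left_haar_measure G m \<longleftrightarrow>
     sets m = sets (restrict_space borel (carrier G)) \<and>
     (\<forall>K. compact K \<and> K \<subseteq> carrier G \<longrightarrow> emeasure m K < \<infinity>) \<and>
     emeasure m (carrier G) \<noteq> 0 \<and>
     (\<forall>a\<in>carrier G. distr m m (\<lambda>x. a \<otimes>\<^bsub>G\<^esub> x) = m)"

definition unimodular :: "('g::topological_space, 'b) monoid_scheme \<Rightarrow> bool" where
  "unimodular G \<longleftrightarrow>
     (\<forall>m. left_haar_measure G m \<longrightarrow> (\<forall>a\<in>carrier G. distr m m (\<lambda>x. x \<otimes>\<^bsub>G\<^esub> a) = m))"

section \<open>The homogeneous space of right cosets\<close>

definition coset_topology ::
  "('g::topological_space, 'b) monoid_scheme \<Rightarrow> 'g set \<Rightarrow> 'g set topology" where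
  "coset_topology G H =
     topology (\<lambda>U. U \<subseteq> rcosets\<^bsub>G\<^esub> H \<and> open {g. H #>\<^bsub>G\<^esub> g \<in> U})"

lemma openin_coset_topology:
  "openin (coset_topology G H) U \<longleftrightarrow> U \<subseteq> rcosets\<^bsub>G\<^esub> H \<and> open {g. H #>\<^bsub>G\<^esub> g \<in> U}"
proof -
  have "istopology (\<lambda>U. U \<subseteq> rcosets\<^bsub>G\<^esub> H \<and> open {g. H #>\<^bsub>G\<^esub> g \<in> U})"
    unfolding istopology_def
  proof (rule conjI; intro allI impI)
    fix S T :: "'a set set"
    assume S: "S \<subseteq> rcosets\<^bsub>G\<^esub> H \<and> open {g. H #>\<^bsub>G\<^esub> g \<in> S}"
      and T: "T \<subseteq> rcosets\<^bsub>G\<^esub> H \<and> open {g. H #>\<^bsub>G\<^esub> g \<in> T}"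
    have "{g. H #>\<^bsub>G\<^esub> g \<in> S \<inter> T} = {g. H #>\<^bsub>G\<^esub> g \<in> S} \<inter> {g. H #>\<^bsub>G\<^esub> g \<in> T}"
      by auto
    with S T show "S \<inter> T \<subseteq> rcosets\<^bsub>G\<^esub> H \<and> open {g. H #>\<^bsub>G\<^esub> g \<in> S \<inter> T}"
      by (auto intro: open_Int)
  next
    fix \<K> :: "'a set set set"
    assume K: "\<forall>U\<in>\<K>. U \<subseteq> rcosets\<^bsub>G\<^esub> H \<and> open {g. H #>\<^bsub>G\<^esub> g \<in> U}"
    have "{g. H #>\<^bsub>G\<^esub> g \<in> \<Union>\<K>} = (\<Union>U\<in>\<K>. {g. H #>\<^bsub>G\<^esub> g \<in> U})"
      by auto
    moreover have "open (\<Union>U\<in>\<K>. {g. H #>\<^bsub>G\<^esub> g \<in> U})"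
      using K by (intro open_UN) blast
    ultimately show "\<Union>\<K> \<subseteq> rcosets\<^bsub>G\<^esub> H \<and> open {g. H #>\<^bsub>G\<^esub> g \<in> \<Union>\<K>}"
      using K by auto
  qed
  then show ?thesis
    by (simp add: coset_topology_def topology_inverse')
qed

lemma (in lcsc_group) topspace_coset_topology:
  "topspace (coset_topology G H) = rcosets H"
proof -
  have "{g. H #> g \<in> rcosets H} = UNIV"
    using carrier_UNIV by (auto simp: RCOSETS_def)
  then have "openin (coset_topology G H) (rcosets H)"
    by (simp add: openin_coset_topology)
  then show ?thesis
    by (intro equalityI openin_subset)
       (auto simp: topspace_def openin_coset_topology)
qed

text \<open>
  The value at the coset \<open>c = Hg\<close> of the function \<open>Hg \<mapsto> \<Phi> g\<close>. It is used only for \<open>\<Phi>\<close> that are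
  constant on the cosets of \<open>H\<close> (by invariance of the measures on \<open>H\<close> and on the cross section).
\<close>

definition at_coset :: "('g \<Rightarrow> 'a) \<Rightarrow> 'g set \<Rightarrow> 'a" where
  "at_coset \<Phi> c = \<Phi> (SOME g. g \<in> c)"

definition quotient_measure ::
  "('g::topological_space, 'b) monoid_scheme \<Rightarrow> 'g set \<Rightarrow> 'g measure \<Rightarrow> 'g measure \<Rightarrow>
   'g set measure \<Rightarrow> bool" where
  "quotient_measure G H mG mH m \<longleftrightarrow>
     sets m = sets (borel_of (coset_topology G H)) \<and>
     (\<forall>K. compactin (coset_topology G H) K \<longrightarrow> emeasure m K < \<infinity>) \<and>
     (\<forall>g\<in>carrier G. distr m m (\<lambda>c. c #>\<^bsub>G\<^esub> g) = m) \<and>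
     (\<forall>f\<in>Cc euclidean.
        (LINT g|mG. f g) = (LINT c|m. at_coset (\<lambda>g. LINT h|mH. f (h \<otimes>\<^bsub>G\<^esub> g)) c))"

section \<open>Cross sections and transverse systems\<close>

text \<open>\<open>X\<close> only serves as a measurable space.\<close>

definition standard_borel_G_space ::
  "('g::topological_space, 'b) monoid_scheme \<Rightarrow> 'x measure \<Rightarrow> ('g \<Rightarrow> 'x \<Rightarrow> 'x) \<Rightarrow> bool" where
  "standard_borel_G_space G X act \<longleftrightarrow>
     standard_borel X \<and> group_action G (space X) act \<and>
     (\<lambda>(g, x). act g x) \<in> borel \<Otimes>\<^sub>M X \<rightarrow>\<^sub>M X"

definition cross_section ::
  "('g, 'b) monoid_scheme \<Rightarrow> 'g set \<Rightarrow> 'x measure \<Rightarrow> ('g \<Rightarrow> 'x \<Rightarrow> 'x) \<Rightarrow> 'x set \<Rightarrow> bool" where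
  "cross_section G H X act Y \<longleftrightarrow>
     Y \<in> sets X \<and> (\<Union>g\<in>carrier G. act g ` Y) = space X \<and> (\<Union>h\<in>H. act h ` Y) = Y"

definition hitting_times ::
  "('g, 'b) monoid_scheme \<Rightarrow> 'g set \<Rightarrow> ('g \<Rightarrow> 'x \<Rightarrow> 'x) \<Rightarrow> 'x set \<Rightarrow> 'x \<Rightarrow> 'g set set" where
  "hitting_times G H act Y x = {H #>\<^bsub>G\<^esub> g | g. g \<in> carrier G \<and> act g x \<in> Y}"

definition transverse_system ::
  "('g::topological_space, 'b) monoid_scheme \<Rightarrow> 'g set \<Rightarrow> 'x measure \<Rightarrow> ('g \<Rightarrow> 'x \<Rightarrow> 'x) \<Rightarrow>
   'x set \<Rightarrow> 'x measure \<Rightarrow> bool" where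
  "transverse_system G H X act Y \<mu> \<longleftrightarrow>
     standard_borel_G_space G X act \<and> cross_section G H X act Y \<and>
     prob_space \<mu> \<and> sets \<mu> = sets X \<and> (\<forall>g\<in>carrier G. distr \<mu> \<mu> (act g) = \<mu>)"

text \<open>
  The measurability clause expresses that the integral of the counting function makes sense;
  without it, the library integral would be a lower integral.
\<close>

definition integrable_transverse_system ::
  "('g::topological_space, 'b) monoid_scheme \<Rightarrow> 'g set \<Rightarrow> 'x measure \<Rightarrow> ('g \<Rightarrow> 'x \<Rightarrow> 'x) \<Rightarrow>
   'x set \<Rightarrow> 'x measure \<Rightarrow> bool" where
  "integrable_transverse_system G H X act Y \<mu> \<longleftrightarrow>
     transverse_system G H X act Y \<mu> \<and>
     (\<forall>L. compactin (coset_topology G H) L \<longrightarrow>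
        (\<lambda>x. emeasure (count_space UNIV) (hitting_times G H act Y x \<inter> L))
          \<in> borel_measurable (completion \<mu>) \<and>
        (\<integral>\<^sup>+x. emeasure (count_space UNIV) (hitting_times G H act Y x \<inter> L) \<partial>completion \<mu>) < \<infinity>)"

definition transverse_measure ::
  "('g::topological_space, 'b) monoid_scheme \<Rightarrow> 'g set \<Rightarrow> 'g measure \<Rightarrow> 'g measure \<Rightarrow>
   'x measure \<Rightarrow> ('g \<Rightarrow> 'x \<Rightarrow> 'x) \<Rightarrow> 'x set \<Rightarrow> 'x measure \<Rightarrow> 'x measure \<Rightarrow> bool" where
  "transverse_measure G H mG mH X act Y \<mu> \<sigma> \<longleftrightarrow>
     finite_measure \<sigma> \<and> sets \<sigma> = sets (restrict_space X Y) \<and>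
     (\<forall>h\<in>H. distr \<sigma> \<sigma> (act h) = \<sigma>) \<and>
     (\<forall>F :: 'g \<times> 'x \<Rightarrow> complex.
        F \<in> borel_measurable (borel \<Otimes>\<^sub>M restrict_space X Y) \<and>
        (\<exists>C. \<forall>g\<in>carrier G. \<forall>y\<in>Y. norm (F (g, y)) \<le> C) \<and>
        (\<exists>L. compact L \<and> L \<subseteq> carrier G \<and> (\<forall>g\<in>carrier G - L. \<forall>y\<in>Y. F (g, y) = 0)) \<longrightarrow>
        (LINT x|completion \<mu>. (\<Sum>\<^sub>\<infinity>c\<in>hitting_times G H act Y x.
            at_coset (\<lambda>g. LINT h|mH. F (inv\<^bsub>G\<^esub> (h \<otimes>\<^bsub>G\<^esub> g), act (h \<otimes>\<^bsub>G\<^esub> g) x)) c)) =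
        (LINT g|mG. LINT y|\<sigma>. F (g, y)))"

section \<open>The transform and its dual\<close>

definition transverse_sum ::
  "('g, 'b) monoid_scheme \<Rightarrow> 'g set \<Rightarrow> ('g \<Rightarrow> 'x \<Rightarrow> 'x) \<Rightarrow> 'x set \<Rightarrow>
   ('g set \<Rightarrow> complex) \<Rightarrow> 'x \<Rightarrow> complex" where
  "transverse_sum G H act Y f x = (\<Sum>\<^sub>\<infinity>c\<in>hitting_times G H act Y x. f c)"

definition transverse_dual ::
  "('g, 'b) monoid_scheme \<Rightarrow> ('g \<Rightarrow> 'x \<Rightarrow> 'x) \<Rightarrow> 'x measure \<Rightarrow>
   ('x \<Rightarrow> complex) \<Rightarrow> 'g set \<Rightarrow> complex" where
  "transverse_dual G act \<sigma> \<phi> = at_coset (\<lambda>g. LINT y|completion \<sigma>. \<phi> (act (inv\<^bsub>G\<^esub> g) y))"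

end

theory Submission
  imports Defs
begin

text \<open>
  Apply the identity defining \<open>\<sigma>\<close> to \<open>F(g, y) = \<psi>(g\<inverse>) \<phi>(g.y)\<close>. On the left the inner integral is
  \<open>\<phi>(x) \<integral>\<psi>(hg) dm\<^sub>H(h)\<close>, so the left side is \<open>\<integral> Sf \<cdot> \<phi> d\<mu>\<close> as soon as \<open>f\<close> is the integral of \<open>\<psi>\<close> along
  the cosets; by inversion invariance of \<open>m\<^sub>G\<close> the right side is \<open>\<integral> \<psi>(g) S\<^sup>*\<phi>(Hg) dm\<^sub>G(g)\<close>, which Weil's
  formula folds to \<open>\<integral> f \<cdot> S\<^sup>*\<phi>\<close> over the homogeneous space. Since \<open>F\<close> only has to be Borel, a suitable \<open>\<psi>\<close> is obtained
  from \<open>f\<close> by multiplying with a normalized indicator function of a compact set.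

  The same identity for the indicator function of a null set \<open>N\<close> shows that \<open>\<sigma>(gN) = 0\<close> for almost every
  coset, which makes \<open>S\<^sup>*\<close> well defined. Measurability of \<open>Sf\<close> comes from the counting functions of
  compact sets, whose measurability is part of integrability.
\<close>

text \<open>Weil's formula is given only for continuous functions of compact support, while the test
  functions used here are merely Borel, so it has to be extended to all nonnegative Borel functions.
  The obstacle is measurability on the quotient: \<open>at_coset\<close> evaluates at an arbitrary
  representative, and no Borel section is used. Integration along the cosets takes its place. Coset
  integrals of open sets are lower semicontinuous, which yields measurability for all Borel sets;
  and for an invariant Borel set A the coset integral of the indicator is m_H(H) times the
  indicator, so the image of A is recovered as the set where it does not vanish.

  The identity defining \<sigma> admits only test functions bounded at every point. For this reason
  the cutoff is divided by its coset integral only where that integral exceeds a positive constant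
  \<delta>, the measure of a small piece of H, and an essentially bounded \<phi> is first replaced
  by a bounded Borel function. The null set statement is what allows the replacement on the dual
  side.\<close>

section \<open>Topology and Borel structure of the group\<close>

context lcsc_group
begin

lemma in_carrier [simp, intro]: "g \<in> carrier G"
  by (simp add: carrier_UNIV)

lemma continuous_on_mult_compose:
  assumes "continuous_on S f" "continuous_on S k"
  shows "continuous_on S (\<lambda>x. f x \<otimes> k x)"
  using continuous_on_compose2[OF continuous_mult continuous_on_Pair[OF assms]] by simp

lemma tendsto_mult_compose:
  assumes "(f \<longlongrightarrow> a) F" "(k \<longlongrightarrow> b) F"
  shows "((\<lambda>x. f x \<otimes> k x) \<longlongrightarrow> a \<otimes> b) F"
  using continuous_on_tendsto_compose[OF continuous_mult tendsto_Pair[OF assms]] by simp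

lemma tendsto_inv_compose:
  assumes "(f \<longlongrightarrow> a) F"
  shows "((\<lambda>x. inv f x) \<longlongrightarrow> inv a) F"
  using continuous_on_tendsto_compose[OF continuous_inv assms] by simp

lemma measurable_mult_compose [measurable (raw)]:
  assumes "f \<in> borel_measurable M" "k \<in> borel_measurable M"
  shows "(\<lambda>x. f x \<otimes> k x) \<in> borel_measurable M"
proof -
  have "(\<lambda>p. fst p \<otimes> snd p) \<in> borel_measurable (borel \<Otimes>\<^sub>M borel)"
    using borel_measurable_continuous_onI[OF continuous_mult] by (simp add: borel_prod)
  from measurable_compose[OF measurable_Pair[OF assms] this] show ?thesis
    by simp
qed

lemma measurable_inv_compose [measurable (raw)]:
  assumes "f \<in> borel_measurable M"
  shows "(\<lambda>x. inv f x) \<in> borel_measurable M"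
  using measurable_compose[OF assms borel_measurable_continuous_onI[OF continuous_inv]] .

lemma compact_mult_image:
  assumes "compact A" "compact B"
  shows "compact ((\<lambda>p. fst p \<otimes> snd p) ` (A \<times> B))"
  by (intro compact_continuous_image compact_Times assms continuous_on_subset[OF continuous_mult]) auto

lemma compact_inv_image:
  assumes "compact A"
  shows "compact ((\<lambda>x. inv x) ` A)"
  by (intro compact_continuous_image assms continuous_on_subset[OF continuous_inv]) auto

text \<open>By local compactness the open sets contained in compact sets cover the group, and by the
  Lindelof property countably many of them do; the W n are their finite unions. This reduces later
  arguments to sets of finite measure.\<close>

lemma exhaustion:
  obtains W :: "nat \<Rightarrow> 'g set"
  where "\<And>n. open (W n)" "\<And>n. compact (closure (W n))" "incseq W" "(\<Union>n. W n) = UNIV"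
proof -
  define F where "F = {U :: 'g set. open U \<and> (\<exists>K. compact K \<and> U \<subseteq> K)}"
  have F_UNIV: "\<Union>F = UNIV"
    using locally_compact unfolding F_def locally_compact_space_def by fastforce
  obtain F' where F': "F' \<subseteq> F" "countable F'" "\<Union>F' = \<Union>F"
    by (rule Lindelof[of F]) (auto simp: F_def)
  have ne: "F' \<noteq> {}"
    using F'(3) F_UNIV by auto
  define W where "W n = (\<Union>i\<le>n. from_nat_into F' i)" for n
  have mem: "from_nat_into F' i \<in> F" for i
    using from_nat_into[OF ne] F'(1) by blast
  show ?thesis
  proof
    show "open (W n)" for n
      using mem unfolding W_def F_def by blast
    show "compact (closure (W n))" for n
    proof -
      obtain K where K: "\<And>i. compact (K i)" "\<And>i. from_nat_into F' i \<subseteq> K i"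
        using mem unfolding F_def by simp metis
      have "compact (\<Union>i\<le>n. K i)"
        using K by (intro compact_UN) auto
      moreover have "W n \<subseteq> (\<Union>i\<le>n. K i)"
        using K(2) unfolding W_def by blast
      ultimately show ?thesis
        by (metis closed_closure closure_minimal compact_Int_closed compact_imp_closed inf.absorb_iff2)
    qed
    show "incseq W"
      unfolding W_def by (intro monoI UN_mono) auto
    have "(\<Union>n. W n) = (\<Union>i. from_nat_into F' i)"
      unfolding W_def by blast
    also have "\<dots> = UNIV"
      using F' F_UNIV range_from_nat_into[OF ne F'(2)] by simp
    finally show "(\<Union>n. W n) = UNIV" .
  qed
qed

text \<open>Urysohn's lemma needs normality, and no metric is at hand: locally compact Hausdorff
  spaces are regular, second countable ones are Lindelof, and regular Lindelof spaces are
  normal.\<close>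

lemma normal: "normal_space (euclidean :: 'g topology)" and regular: "regular_space (euclidean :: 'g topology)"
proof -
  show reg: "regular_space (euclidean :: 'g topology)"
  proof (rule locally_compact_Hausdorff_imp_regular_space[OF locally_compact])
    show "Hausdorff_space (euclidean :: 'g topology)"
      unfolding Hausdorff_space_def by (simp add: disjnt_def) (metis hausdorff)
  qed
  have "second_countable (euclidean :: 'g topology)"
  proof -
    obtain B :: "'g set set" where "countable B" "\<And>X. X \<in> B \<Longrightarrow> open X"
      "\<And>S. open S \<Longrightarrow> \<exists>U. U \<subseteq> B \<and> S = \<Union>U"
      using univ_second_countable by blast
    then show ?thesis
      unfolding second_countable_def by (intro exI[of _ B]) (simp, blast)
  qed
  with reg show "normal_space (euclidean :: 'g topology)"
    by (intro regular_Lindelof_imp_normal_space second_countable_imp_Lindelof_space)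
qed

text \<open>Regularity puts around each point of U an open set whose closure stays in U. Countably
  many of them suffice by the Lindelof property, and finite unions of the closures increase to
  U.\<close>

lemma open_eq_increasing_closed:
  assumes "open (U :: 'g set)"
  obtains F where "\<And>n::nat. closed (F n)" "incseq F" "(\<Union>n. F n) = U"
proof -
  define E where "E = {V :: 'g set. open V \<and> closure V \<subseteq> U}"
  have "\<exists>V\<in>E. x \<in> V" if "x \<in> U" for x
  proof -
    have "openin euclidean U \<and> x \<in> U"
      using assms that by simp
    then obtain V C where "open V" "closed C" "x \<in> V" "V \<subseteq> C" "C \<subseteq> U"
      using regular unfolding neighbourhood_base_of_closedin[symmetric] neighbourhood_base_of
      by (metis closed_closedin open_openin)
    then show ?thesis
      unfolding E_def using closure_minimal by blast
  qed
  then have E: "\<Union>E = U"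
    unfolding E_def using closure_subset by blast
  obtain E' where E': "E' \<subseteq> E" "countable E'" "\<Union>E' = \<Union>E"
    by (rule Lindelof[of E]) (auto simp: E_def)
  show ?thesis
  proof (cases "E' = {}")
    case True
    with E E' have "U = {}"
      by simp
    then show ?thesis
      by (intro that[of "\<lambda>_. {}"]) (auto simp: incseq_def)
  next
    case False
    define F where "F n = (\<Union>i\<le>n. closure (from_nat_into E' i))" for n
    have mem: "from_nat_into E' i \<in> E" for i
      using from_nat_into[OF False] E'(1) by blast
    show ?thesis
    proof
      show "closed (F n)" for n
        unfolding F_def by (intro closed_UN) auto
      show "incseq F"
        unfolding F_def by (intro monoI UN_mono) auto
      have "(\<Union>n. F n) \<subseteq> U"
        unfolding F_def using mem E_def by blast
      moreover have "U \<subseteq> (\<Union>i. from_nat_into E' i)"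
        using E E' range_from_nat_into[OF False E'(2)] by simp
      moreover have "(\<Union>i. from_nat_into E' i) \<subseteq> (\<Union>n. F n)"
        unfolding F_def using closure_subset by blast
      ultimately show "(\<Union>n. F n) = U"
        by blast
    qed
  qed
qed

text \<open>The Urysohn functions are 1 on the n-th closed set exhausting U and 0 off U, so every
  point of U eventually sees the value 1. They link the quotient measure, which is characterized
  through continuous functions, to open sets.\<close>

lemma open_indicator_limit_continuous:
  assumes "open (U :: 'g set)"
  obtains u :: "nat \<Rightarrow> 'g \<Rightarrow> real"
  where "\<And>n. continuous_on UNIV (u n)" "\<And>n x. 0 \<le> u n x" "\<And>n x. u n x \<le> indicator U x"
    "\<And>x. (\<lambda>n. u n x) \<longlonglongrightarrow> indicator U x"
proof -
  obtain F where F: "\<And>n::nat. closed (F n)" "incseq F" "(\<Union>n. F n) = U"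
    using open_eq_increasing_closed[OF assms] by blast
  have "\<exists>f. continuous_map euclidean (top_of_set {0..1::real}) f \<and>
      f ` (- U) \<subseteq> {0} \<and> f ` (F n) \<subseteq> {1}" for n
  proof -
    have "disjnt (- U) (F n)"
      using F(3) unfolding disjnt_def by blast
    then show ?thesis
      using Urysohn_lemma[OF normal, of "- U" "F n" 0 1] F(1) assms
      by (metis closed_Compl closed_closedin zero_le_one)
  qed
  then obtain u where u: "\<And>n. continuous_map euclidean (top_of_set {0..1::real}) (u n)"
    "\<And>n. u n ` (- U) \<subseteq> {0}" "\<And>n. u n ` (F n) \<subseteq> {1}"
    by metis
  have rng: "u n x \<in> {0..1}" for n x
    using u(1)[of n] unfolding continuous_map_in_subtopology by auto
  show ?thesis
  proof
    show "continuous_on UNIV (u n)" for n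
      using u(1)[of n] unfolding continuous_map_in_subtopology by simp
    show "0 \<le> u n x" for n x
      using rng[of n x] by simp
    show "u n x \<le> indicator U x" for n x
      using rng[of n x] u(2)[of n] by (cases "x \<in> U") auto
    show "(\<lambda>n. u n x) \<longlonglongrightarrow> indicator U x" for x
    proof (cases "x \<in> U")
      case True
      then obtain N where "x \<in> F N"
        using F(3) by blast
      then have "u n x = 1" if "n \<ge> N" for n
        using u(3)[of n] incseqD[OF F(2) that] by blast
      with True show ?thesis
        by (intro tendsto_eventually) (auto simp: eventually_sequentially)
    next
      case False
      then have "u n x = 0" for n
        using u(2)[of n] by auto
      with False show ?thesis
        by simp
    qed
  qed
qed

end

section \<open>Haar measure of a unimodular group and its inversion invariance\<close>

locale unimodular_haar = lcsc_group G
  for G :: "('g::{t2_space, second_countable_topology}, 'b) monoid_scheme" (structure) +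
  fixes mG :: "'g measure"
  assumes unimod: "unimodular G" and haar: "left_haar_measure G mG"
begin

lemma sets_haar [measurable_cong, simp]: "sets mG = sets borel"
  using haar by (simp add: left_haar_measure_def carrier_UNIV)

lemma space_haar [simp]: "space mG = UNIV"
  using sets_eq_imp_space_eq[OF sets_haar] by simp

lemma haar_finite_on_compact: "compact K \<Longrightarrow> emeasure mG K < \<infinity>"
  using haar by (simp add: left_haar_measure_def carrier_UNIV)

lemma distr_left: "distr mG mG (\<lambda>x. a \<otimes> x) = mG"
  using haar by (simp add: left_haar_measure_def carrier_UNIV)

lemma distr_right: "distr mG mG (\<lambda>x. x \<otimes> a) = mG"
  using haar unimod by (simp add: unimodular_def carrier_UNIV)

lemma nn_integral_left:
  assumes [measurable]: "f \<in> borel_measurable borel"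
  shows "(\<integral>\<^sup>+x. f (a \<otimes> x) \<partial>mG) = (\<integral>\<^sup>+x. f x \<partial>mG)"
  by (subst (2) distr_left[of a, symmetric]) (simp add: nn_integral_distr)

lemma nn_integral_right:
  assumes [measurable]: "f \<in> borel_measurable borel"
  shows "(\<integral>\<^sup>+x. f (x \<otimes> a) \<partial>mG) = (\<integral>\<^sup>+x. f x \<partial>mG)"
  by (subst (2) distr_right[of a, symmetric]) (simp add: nn_integral_distr)

lemma sigma_finite_haar: "sigma_finite_measure mG"
proof -
  obtain W :: "nat \<Rightarrow> 'g set" where W: "\<And>n. open (W n)" "\<And>n. compact (closure (W n))"
      "incseq W" "(\<Union>n. W n) = UNIV"
    using exhaustion by blast
  have "emeasure mG (W n) < \<infinity>" for n
    using haar_finite_on_compact[OF W(2)] closure_subset[of "W n"]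
      emeasure_mono[of "W n" "closure (W n)" mG] by (metis borel_closed closed_closure le_less_trans sets_haar)
  with W show ?thesis
    by (intro sigma_finite_measure.intro exI[of _ "range W"]) (auto simp: less_top[symmetric])
qed

text \<open>
  For \<open>n(f) = m(f(x\<inverse>))\<close>, both translation invariances and Fubini transform \<open>m(f) n(k)\<close>
  into \<open>n(f) n(k)\<close>, without appeal to the uniqueness of Haar measure.
\<close>

lemma distr_inv: "distr mG mG (\<lambda>x. inv x) = mG"
proof -
  interpret sigma_finite_measure mG
    by (rule sigma_finite_haar)
  interpret pair_sigma_finite mG mG ..
  obtain W :: "nat \<Rightarrow> 'g set" where W: "\<And>n. open (W n)" "\<And>n. compact (closure (W n))"
      "incseq W" "(\<Union>n. W n) = UNIV"
    using exhaustion by blast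
  have "\<exists>n. emeasure mG (W n) \<noteq> 0"
  proof (rule ccontr)
    assume "\<nexists>n. emeasure mG (W n) \<noteq> 0"
    then have "emeasure mG (\<Union>n. W n) = 0"
      using W(1) by (intro emeasure_UN_eq_0) auto
    then show False
      using haar W(4) by (simp add: left_haar_measure_def carrier_UNIV)
  qed
  then obtain n where n: "emeasure mG (W n) \<noteq> 0" by blast
  \<comment> \<open>The indicator of the inverse of W n: composed with inversion it integrates to
    the measure of W n, which is positive and finite and can be cancelled at the end.\<close>
  define k :: "'g \<Rightarrow> ennreal" where "k x = indicator (W n) (inv x)" for x
  have [measurable]: "W n \<in> sets borel"
    using W(1) by simp
  have k[measurable]: "k \<in> borel_measurable borel"
    unfolding k_def by measurable
  have k_fin: "(\<integral>\<^sup>+x. k (inv x) \<partial>mG) \<noteq> 0" "(\<integral>\<^sup>+x. k (inv x) \<partial>mG) \<noteq> \<infinity>"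
  proof -
    have "(\<integral>\<^sup>+x. k (inv x) \<partial>mG) = emeasure mG (W n)"
      by (simp add: k_def)
    moreover have "emeasure mG (W n) \<noteq> \<infinity>"
      using haar_finite_on_compact[OF W(2), of n] closure_subset[of "W n"]
        emeasure_mono[of "W n" "closure (W n)" mG] by auto
    ultimately show "(\<integral>\<^sup>+x. k (inv x) \<partial>mG) \<noteq> 0" "(\<integral>\<^sup>+x. k (inv x) \<partial>mG) \<noteq> \<infinity>"
      using n by auto
  qed
  have key: "(\<integral>\<^sup>+x. f x \<partial>mG) = (\<integral>\<^sup>+x. f (inv x) \<partial>mG)"
    if f[measurable]: "f \<in> borel_measurable borel" for f :: "'g \<Rightarrow> ennreal"
  proof -
    have "(\<integral>\<^sup>+x. f x \<partial>mG) * (\<integral>\<^sup>+y. k (inv y) \<partial>mG) = (\<integral>\<^sup>+x. f x * (\<integral>\<^sup>+y. k (inv y) \<partial>mG) \<partial>mG)"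
      by (simp add: nn_integral_multc)
    \<comment> \<open>Right invariance, and with it unimodularity, replaces y by y x in the inner
      integral.\<close>
    also have "\<dots> = (\<integral>\<^sup>+x. f x * (\<integral>\<^sup>+y. k (inv (y \<otimes> x)) \<partial>mG) \<partial>mG)"
      by (subst nn_integral_right[of "\<lambda>y. k (inv y)"]) auto
    also have "\<dots> = (\<integral>\<^sup>+x. \<integral>\<^sup>+y. f x * k (inv (y \<otimes> x)) \<partial>mG \<partial>mG)"
      by (simp add: nn_integral_cmult)
    also have "\<dots> = (\<integral>\<^sup>+y. \<integral>\<^sup>+x. f x * k (inv (y \<otimes> x)) \<partial>mG \<partial>mG)"
      by (rule Fubini'[symmetric]) measurable
    \<comment> \<open>Left invariance substitutes y^-1 x for x, after which y disappears from the
      argument of k.\<close>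
    also have "\<dots> = (\<integral>\<^sup>+y. \<integral>\<^sup>+x. f (inv y \<otimes> x) * k (inv (y \<otimes> (inv y \<otimes> x))) \<partial>mG \<partial>mG)"
    proof (rule nn_integral_cong)
      fix y
      show "(\<integral>\<^sup>+x. f x * k (inv (y \<otimes> x)) \<partial>mG)
          = (\<integral>\<^sup>+x. f (inv y \<otimes> x) * k (inv (y \<otimes> (inv y \<otimes> x))) \<partial>mG)"
        by (rule nn_integral_left[symmetric]) measurable
    qed
    also have "\<dots> = (\<integral>\<^sup>+y. \<integral>\<^sup>+x. f (inv y \<otimes> x) * k (inv x) \<partial>mG \<partial>mG)"
      by (simp add: m_assoc[symmetric])
    also have "\<dots> = (\<integral>\<^sup>+x. \<integral>\<^sup>+y. f (inv y \<otimes> x) * k (inv x) \<partial>mG \<partial>mG)"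
      by (rule Fubini') measurable
    \<comment> \<open>Left invariance once more: substituting x y for y turns y^-1 x into y^-1, and
      the two variables separate.\<close>
    also have "\<dots> = (\<integral>\<^sup>+x. \<integral>\<^sup>+y. f (inv (x \<otimes> y) \<otimes> x) * k (inv x) \<partial>mG \<partial>mG)"
    proof (rule nn_integral_cong)
      fix x
      show "(\<integral>\<^sup>+y. f (inv y \<otimes> x) * k (inv x) \<partial>mG) = (\<integral>\<^sup>+y. f (inv (x \<otimes> y) \<otimes> x) * k (inv x) \<partial>mG)"
        by (rule nn_integral_left[symmetric]) measurable
    qed
    also have "\<dots> = (\<integral>\<^sup>+x. \<integral>\<^sup>+y. f (inv y) * k (inv x) \<partial>mG \<partial>mG)"
      by (simp add: m_assoc inv_mult_group)
    also have "\<dots> = (\<integral>\<^sup>+y. f (inv y) \<partial>mG) * (\<integral>\<^sup>+x. k (inv x) \<partial>mG)"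
      by (simp add: nn_integral_multc nn_integral_cmult)
    finally show ?thesis
      using k_fin by (metis ennreal_mult_cancel_left infinity_ennreal_def mult.commute)
  qed
  show ?thesis
  proof (rule measure_eqI)
    fix A assume "A \<in> sets (distr mG mG (\<lambda>x. inv x))"
    then have A[measurable]: "A \<in> sets borel"
      by simp
    have "emeasure (distr mG mG (\<lambda>x. inv x)) A = (\<integral>\<^sup>+x. indicator A (inv x) \<partial>mG)"
      by (subst nn_integral_indicator[symmetric]) (auto simp: nn_integral_distr simp del: nn_integral_indicator)
    also have "\<dots> = emeasure mG A"
      using key[of "indicator A"] by simp
    finally show "emeasure (distr mG mG (\<lambda>x. inv x)) A = emeasure mG A" .
  qed simp
qed

end

locale homogeneous_pair = unimodular_haar G mG
  for G :: "('g::{t2_space, second_countable_topology}, 'b) monoid_scheme" (structure)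
    and mG :: "'g measure" +
  fixes H :: "'g set" and mH :: "'g measure" and mQ :: "'g set measure"
  assumes H_subgroup: "subgroup H G" and H_closed: "closed H"
    and H_unimod: "unimodular (G\<lparr>carrier := H\<rparr>)"
    and H_haar: "left_haar_measure (G\<lparr>carrier := H\<rparr>) mH"
    and mQ: "quotient_measure G H mG mH mQ"
begin

abbreviation T where "T \<equiv> coset_topology G H"

abbreviation proj where "proj g \<equiv> H #> g"

section \<open>Right cosets\<close>

lemma H_borel [measurable]: "H \<in> sets borel"
  using H_closed by simp

lemma sets_mH: "sets mH = sets (restrict_space borel H)"
  using H_haar by (simp add: left_haar_measure_def)

lemma space_mH [simp]: "space mH = H"
  using sets_eq_imp_space_eq[OF sets_mH] by (simp add: space_restrict_space)

lemma measurable_mH: "f \<in> borel \<rightarrow>\<^sub>M N \<Longrightarrow> f \<in> mH \<rightarrow>\<^sub>M N"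
  unfolding measurable_cong_sets[OF sets_mH refl] by (rule measurable_restrict_space1)

lemma mH_finite_on_compact: "compact K \<Longrightarrow> K \<subseteq> H \<Longrightarrow> emeasure mH K < \<infinity>"
  using H_haar by (simp add: left_haar_measure_def)

lemma emeasure_mH_H: "emeasure mH H \<noteq> 0"
  using H_haar by (simp add: left_haar_measure_def)

lemma H_mult [simp, intro]: "a \<in> H \<Longrightarrow> b \<in> H \<Longrightarrow> a \<otimes> b \<in> H"
  and H_inv [simp, intro]: "a \<in> H \<Longrightarrow> inv a \<in> H"
  and H_one [simp, intro]: "\<one> \<in> H"
  using H_subgroup by (auto simp: subgroup.m_closed subgroup.m_inv_closed subgroup.one_closed)

text \<open>Unimodularity of H makes its left Haar measure right invariant; therefore the integral
  of w(h g) over h depends only on the coset of g.\<close>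

lemma nn_integral_mH_right:
  assumes [measurable]: "f \<in> borel_measurable borel" and a: "a \<in> H"
  shows "(\<integral>\<^sup>+h. f (h \<otimes> a) \<partial>mH) = (\<integral>\<^sup>+h. f h \<partial>mH)"
proof -
  have "distr mH mH (\<lambda>x. x \<otimes> a) = mH"
    using H_unimod H_haar a by (auto simp: unimodular_def)
  moreover have "(\<lambda>x. x \<otimes> a) \<in> mH \<rightarrow>\<^sub>M mH"
    using a unfolding measurable_cong_sets[OF refl sets_mH]
    by (intro measurable_restrict_space2 measurable_mH) (auto intro: measurable_mult_compose)
  ultimately show ?thesis
    using nn_integral_distr[of "\<lambda>x. x \<otimes> a" mH mH f] measurable_mH[OF assms(1)] by simp
qed

lemma proj_eq_iff: "proj g = proj k \<longleftrightarrow> (\<exists>a\<in>H. k = a \<otimes> g)"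
proof
  assume "proj g = proj k"
  then have "k \<in> proj g"
    using rcos_self[OF in_carrier H_subgroup] by simp
  then show "\<exists>a\<in>H. k = a \<otimes> g"
    by (auto simp: r_coset_def)
next
  assume "\<exists>a\<in>H. k = a \<otimes> g"
  then have "k \<in> proj g"
    by (auto simp: r_coset_def)
  then show "proj g = proj k"
    using repr_independence H_subgroup by blast
qed

lemma proj_mult [simp]: "a \<in> H \<Longrightarrow> proj (a \<otimes> g) = proj g"
  using proj_eq_iff by metis

lemma mem_proj_iff: "k \<in> proj g \<longleftrightarrow> proj k = proj g"
  using proj_eq_iff[of g k] by (auto simp: r_coset_def)

lemma rcosets_eq: "rcosets H = range proj"
  by (auto simp: RCOSETS_def)

text \<open>The representative picked by \<open>SOME\<close> differs from g by a left factor in H,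
  so invariance under such factors removes the dependence on the choice.\<close>

lemma at_coset_proj:
  assumes "\<And>a g. a \<in> H \<Longrightarrow> \<Phi> (a \<otimes> g) = \<Phi> g"
  shows "at_coset \<Phi> (proj g) = \<Phi> g"
proof -
  have "(SOME k. k \<in> proj g) \<in> proj g"
    using mem_proj_iff by (metis someI)
  then obtain a where "a \<in> H" "(SOME k. k \<in> proj g) = a \<otimes> g"
    by (auto simp: r_coset_def)
  with assms show ?thesis
    by (simp add: at_coset_def)
qed

lemma sets_mQ: "sets mQ = sets (borel_of T)"
  using mQ by (simp add: quotient_measure_def)

lemma space_mQ [simp]: "space mQ = range proj"
  using sets_eq_imp_space_eq[OF sets_mQ] topspace_coset_topology[of H]
  by (simp add: borel_of_def rcosets_eq space_measure_of_conv)

lemma openin_sets_mQ: "openin T U \<Longrightarrow> U \<in> sets mQ"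
  unfolding sets_mQ borel_of_def using openin_subset[of T]
  by (subst sets_measure_of) auto

lemma topspace_T [simp]: "topspace T = range proj"
  using topspace_coset_topology[of H] by (simp add: rcosets_eq)

lemma openin_T_iff: "openin T U \<longleftrightarrow> U \<subseteq> range proj \<and> open {g. proj g \<in> U}"
  by (simp add: openin_coset_topology rcosets_eq)

text \<open>The union of the cosets that meet U is a union of left translates of U by elements of H,
  hence open.\<close>

lemma openin_proj_image:
  assumes "open U"
  shows "openin T (proj ` U)"
proof -
  have "{g. proj g \<in> proj ` U} = (\<Union>a\<in>H. (\<lambda>g. a \<otimes> g) -` U)"
    using proj_eq_iff by (auto simp: image_iff)
  moreover have "open ((\<lambda>g. a \<otimes> g) -` U)" for a
    by (intro open_vimage assms continuous_on_mult_compose continuous_intros)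
  ultimately show ?thesis
    by (auto simp: openin_T_iff)
qed

lemma continuous_map_proj: "continuous_map euclidean T proj"
  by (auto simp: continuous_map_def openin_T_iff)

lemma compactin_proj_image: "compact K \<Longrightarrow> compactin T (proj ` K)"
  using image_compactin[OF _ continuous_map_proj] by simp

text \<open>The projection being open, the images of the exhausting sets form an open cover of L.
  Finitely many suffice, and their closures upstairs are compact.\<close>

lemma compactin_subset_proj_image:
  assumes L: "compactin T L"
  obtains K where "compact K" "L \<subseteq> proj ` K"
proof -
  obtain W :: "nat \<Rightarrow> 'g set" where W: "\<And>n. open (W n)" "\<And>n. compact (closure (W n))"
      "incseq W" "(\<Union>n. W n) = UNIV"
    using exhaustion by blast
  have "L \<subseteq> (\<Union>n. proj ` W n)"
    using compactin_subset_topspace[OF L] W(4) by (simp add: image_UN[symmetric])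
  then obtain F where F: "finite F" "F \<subseteq> range (\<lambda>n. proj ` W n)" "L \<subseteq> \<Union>F"
    using compactinD[OF L, of "range (\<lambda>n. proj ` W n)"] openin_proj_image[OF W(1)] by blast
  then obtain N where N: "finite N" "F = (\<lambda>n. proj ` W n) ` N"
    by (meson finite_subset_image)
  show ?thesis
  proof
    show "compact (\<Union>n\<in>N. closure (W n))"
      using N W by (intro compact_UN) auto
    show "L \<subseteq> proj ` (\<Union>n\<in>N. closure (W n))"
      using F(3) N(2) closure_subset by blast
  qed
qed

text \<open>The union H K of the cosets meeting K is closed. If x n tends to l and a n x n lies in
  K, a subsequence of a n x n converges to some q in K, so along it a n = (a n x n) (x n)^-1
  converges to q l^-1. As H is closed, this limit lies in H, and l lies in the coset of q.\<close>

lemma proj_image_compact_sets: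
  assumes "compact K"
  shows "proj ` K \<in> sets mQ"
proof -
  have "closed {g. proj g \<in> proj ` K}"
    unfolding closed_sequential_limits
  proof safe
    fix x l assume x: "\<forall>n. x n \<in> {g. proj g \<in> proj ` K}" and l: "x \<longlonglongrightarrow> l"
    have "\<forall>n. \<exists>a. a \<in> H \<and> a \<otimes> x n \<in> K"
    proof
      fix n
      obtain k where k: "k \<in> K" "proj (x n) = proj k"
        using x by blast
      then obtain a where "a \<in> H" "k = a \<otimes> x n"
        using proj_eq_iff[of "x n" k] by blast
      with k show "\<exists>a. a \<in> H \<and> a \<otimes> x n \<in> K" by blast
    qed
    then obtain a where a: "\<forall>n. a n \<in> H \<and> a n \<otimes> x n \<in> K"
      using choice[of "\<lambda>n a. a \<in> H \<and> a \<otimes> x n \<in> K"] by blast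
    define k where "k n = a n \<otimes> x n" for n
    have ak: "\<And>n. a n \<in> H" "\<And>n. k n \<in> K" "\<And>n. k n = a n \<otimes> x n"
      using a by (auto simp: k_def)
    obtain q r where q: "q \<in> K" "strict_mono r" "(k \<circ> r) \<longlonglongrightarrow> q"
      using compact_imp_seq_compact[OF assms] ak(2) by (meson seq_compactE)
    have "(\<lambda>n. k (r n) \<otimes> inv (x (r n))) \<longlonglongrightarrow> q \<otimes> inv l"
      using q(3) LIMSEQ_subseq_LIMSEQ[OF l q(2)]
      by (intro tendsto_mult_compose tendsto_inv_compose) (auto simp: comp_def)
    moreover have "k (r n) \<otimes> inv (x (r n)) = a (r n)" for n
      by (simp add: ak(3) m_assoc)
    ultimately have "(\<lambda>n. a (r n)) \<longlonglongrightarrow> q \<otimes> inv l"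
      by simp
    then have "q \<otimes> inv l \<in> H"
      using closed_sequential_limits[THEN iffD1, OF H_closed, rule_format, of "\<lambda>n. a (r n)"] ak(1) by blast
    then have "proj l = proj q"
      unfolding proj_eq_iff by (intro bexI[of _ "q \<otimes> inv l"]) (auto simp: m_assoc)
    with q(1) show "proj l \<in> proj ` K" by blast
  qed
  moreover have "{g. proj g \<in> range proj - proj ` K} = - {g. proj g \<in> proj ` K}"
    by auto
  ultimately have "openin T (range proj - proj ` K)"
    by (simp add: openin_T_iff open_Compl)
  then have "space mQ - (range proj - proj ` K) \<in> sets mQ"
    by (intro sets.compl_sets openin_sets_mQ)
  moreover have "space mQ - (range proj - proj ` K) = proj ` K"
    by auto
  ultimately show ?thesis by simp
qed

lemma mQ_finite_on_compact: "compactin T L \<Longrightarrow> emeasure mQ L < \<infinity>"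
  using mQ by (simp add: quotient_measure_def)

section \<open>Integration along the cosets\<close>

text \<open>Weil's averaging over cosets. Extended nonnegative values let it apply to every
  nonnegative Borel function before any integrability is known.\<close>

definition fiber :: "('g \<Rightarrow> ennreal) \<Rightarrow> 'g \<Rightarrow> ennreal" where
  "fiber w g = (\<integral>\<^sup>+h. w (h \<otimes> g) \<partial>mH)"

lemma fiber_mult:
  assumes [measurable]: "w \<in> borel_measurable borel" and "a \<in> H"
  shows "fiber w (a \<otimes> g) = fiber w g"
  unfolding fiber_def using nn_integral_mH_right[of "\<lambda>h. w (h \<otimes> g)" a] assms
  by (simp add: m_assoc)

lemma at_coset_fiber:
  "w \<in> borel_measurable borel \<Longrightarrow> at_coset (fiber w) (proj g) = fiber w g"
  by (intro at_coset_proj fiber_mult)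

text \<open>If a g lies in K for some a in H, then g may be replaced by a g, and h (a g) in K forces
  h into K K^-1. The measure of K K^-1 \<inter> H therefore bounds all coset integrals at
  once.\<close>

lemma fiber_compact_bounded:
  assumes K: "compact K"
  obtains M where "M < \<infinity>" "\<And>g. fiber (indicator K) g \<le> M"
proof -
  have [measurable]: "K \<in> sets borel"
    using K by (simp add: borel_compact)
  define D where "D = (\<lambda>p. fst p \<otimes> snd p) ` (K \<times> ((\<lambda>x. inv x) ` K))"
  have D: "compact D"
    unfolding D_def by (intro compact_mult_image compact_inv_image K)
  have [measurable]: "D \<in> sets borel"
    using D by (simp add: borel_compact)
  have bound: "fiber (indicator K) g \<le> emeasure mH (D \<inter> H)" for g
  proof (cases "\<exists>a\<in>H. a \<otimes> g \<in> K")
    case True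
    then obtain a where a: "a \<in> H" "a \<otimes> g \<in> K" by blast
    have "fiber (indicator K) g = fiber (indicator K) (a \<otimes> g)"
      using a by (simp add: fiber_mult)
    also have "\<dots> \<le> (\<integral>\<^sup>+h. indicator (D \<inter> H) h \<partial>mH)"
      unfolding fiber_def
    proof (rule nn_integral_mono)
      fix h assume h: "h \<in> space mH"
      have "h \<in> D" if "h \<otimes> (a \<otimes> g) \<in> K"
        unfolding D_def using that a
        by (intro image_eqI[of _ _ "(h \<otimes> (a \<otimes> g), inv (a \<otimes> g))"]) (auto simp: m_assoc)
      then show "indicator K (h \<otimes> (a \<otimes> g)) \<le> (indicator (D \<inter> H) h :: ennreal)"
        using h by (auto simp: indicator_def)
    qed
    also have "\<dots> = emeasure mH (D \<inter> H)"
    proof (rule nn_integral_indicator)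
      show "D \<inter> H \<in> sets mH"
        unfolding sets_mH sets_restrict_space by (rule image_eqI[of _ _ D]) auto
    qed
    finally show ?thesis .
  next
    case False
    then have "fiber (indicator K) g = (\<integral>\<^sup>+h. 0 \<partial>mH)"
      unfolding fiber_def by (intro nn_integral_cong) auto
    then show ?thesis by simp
  qed
  moreover have "emeasure mH (D \<inter> H) < \<infinity>"
    by (intro mH_finite_on_compact compact_Int_closed D H_closed) auto
  ultimately show ?thesis
    using that by blast
qed

lemma open_Int_stable: "Int_stable {S :: 'g set. open S}"
  by (auto simp: Int_stable_def)

lemma open_subset_Pow: "{S :: 'g set. open S} \<subseteq> Pow UNIV"
  by simp

text \<open>By Fatou's lemma the integral of an open set along the cosets is lower semicontinuous.\<close>

lemma fiber_open_measurable:
  assumes "open U"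
  shows "at_coset (fiber (indicator U)) \<in> borel_measurable mQ"
proof (rule borel_measurableI_greater)
  have [measurable]: "U \<in> sets borel"
    using assms by simp
  fix y :: ennreal
  have "closed {g. fiber (indicator U) g \<le> y}"
    unfolding closed_sequential_limits
  proof safe
    fix x l assume x: "\<forall>n. x n \<in> {g. fiber (indicator U) g \<le> y}" and l: "x \<longlonglongrightarrow> l"
    have "fiber (indicator U) l \<le> (\<integral>\<^sup>+h. liminf (\<lambda>n. indicator U (h \<otimes> x n)) \<partial>mH)"
      unfolding fiber_def
    proof (rule nn_integral_mono)
      fix h
      show "(indicator U (h \<otimes> l) :: ennreal) \<le> liminf (\<lambda>n. indicator U (h \<otimes> x n))"
      proof (cases "h \<otimes> l \<in> U")
        case True
        have "(\<lambda>n. h \<otimes> x n) \<longlonglongrightarrow> h \<otimes> l"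
          by (intro tendsto_mult_compose l tendsto_const)
        then have "eventually (\<lambda>n. h \<otimes> x n \<in> U) sequentially"
          using assms True by (rule topological_tendstoD)
        then have "eventually (\<lambda>n. (1::ennreal) \<le> indicator U (h \<otimes> x n)) sequentially"
          by eventually_elim simp
        then have "1 \<le> liminf (\<lambda>n. indicator U (h \<otimes> x n) :: ennreal)"
          by (rule Liminf_bounded)
        with True show ?thesis by simp
      qed simp
    qed
    also have "\<dots> \<le> liminf (\<lambda>n. fiber (indicator U) (x n))"
      unfolding fiber_def by (intro nn_integral_liminf measurable_mH) measurable
    also have "\<dots> \<le> liminf (\<lambda>n. y)"
      using x by (intro Liminf_mono) auto
    also have "\<dots> = y"
      by (simp add: Liminf_const)
    finally show "fiber (indicator U) l \<le> y" .
  qed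
  then have "open {g. y < fiber (indicator U) g}"
    unfolding closed_def by (rule back_subst[of "open"]) (auto simp: not_le)
  \<comment> \<open>Openness in the quotient is openness of the preimage, so semicontinuity upstairs
    suffices.\<close>
  then have "openin T {c \<in> space mQ. y < at_coset (fiber (indicator U)) c}"
    by (simp add: openin_T_iff at_coset_fiber)
  then show "{c \<in> space mQ. y < at_coset (fiber (indicator U)) c} \<in> sets mQ"
    by (rule openin_sets_mQ)
qed

text \<open>A Dynkin argument starting from the open sets. Its complement step subtracts coset
  integrals, which is sound only for finite values; hence A is cut down to the relatively compact W
  n, and n tends to infinity afterwards.\<close>

lemma fiber_set_measurable:
  assumes A: "A \<in> sets borel"
  shows "at_coset (fiber (indicator A)) \<in> borel_measurable mQ"
proof -
  obtain W :: "nat \<Rightarrow> 'g set" where W: "\<And>n. open (W n)" "\<And>n. compact (closure (W n))"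
      "incseq W" "(\<Union>n. W n) = UNIV"
    using exhaustion by blast
  have W_meas [measurable]: "W n \<in> sets borel" for n
    using W(1) by simp
  have W_fin: "fiber (indicator (A \<inter> W n)) g \<noteq> \<infinity>" for n g A
  proof -
    obtain M where "M < \<infinity>" "\<And>g. fiber (indicator (closure (W n))) g \<le> M"
      using fiber_compact_bounded[OF W(2)] by blast
    moreover have "fiber (indicator (A \<inter> W n)) g \<le> fiber (indicator (closure (W n))) g"
      unfolding fiber_def using closure_subset[of "W n"]
      by (intro nn_integral_mono) (auto simp: indicator_def)
    ultimately show ?thesis
      by (metis infinity_ennreal_def leD le_less_trans)
  qed
  have step: "at_coset (fiber (indicator (A \<inter> W n))) \<in> borel_measurable mQ" for n
  proof -
    have "A \<in> sigma_sets UNIV {S. open S}"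
      using A by (simp add: sets_borel)
    with open_Int_stable open_subset_Pow show ?thesis
    proof (induction rule: sigma_sets_induct_disjoint)
      case (basic A)
      then show ?case
        using W(1) by (intro fiber_open_measurable) auto
    next
      case empty
      then show ?case
        by (simp add: at_coset_def fiber_def)
    next
      case (compl A)
      have [measurable]: "A \<in> sets borel"
        using compl by (simp add: sets_borel)
      have "fiber (indicator ((UNIV - A) \<inter> W n)) g
          = fiber (indicator (W n)) g - fiber (indicator (A \<inter> W n)) g" for g
        unfolding fiber_def using W_fin[of A n g, unfolded fiber_def]
        by (subst nn_integral_diff[symmetric])
          (auto simp: indicator_def intro!: nn_integral_cong measurable_mH)
      then have "at_coset (fiber (indicator ((UNIV - A) \<inter> W n)))
          = (\<lambda>c. at_coset (fiber (indicator (W n))) c - at_coset (fiber (indicator (A \<inter> W n))) c)"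
        by (auto simp: at_coset_def)
      moreover have "at_coset (fiber (indicator (W n))) \<in> borel_measurable mQ"
        using W(1) by (rule fiber_open_measurable)
      ultimately show ?case
        using compl by simp
    next
      case (union A)
      have [measurable]: "A i \<in> sets borel" for i
        using union by (auto simp: sets_borel)
      have "disjoint_family (\<lambda>i. A i \<inter> W n)"
        using union by (auto simp: disjoint_family_on_def)
      then have "indicator ((\<Union>i. A i) \<inter> W n) x = (\<Sum>i. indicator (A i \<inter> W n) x :: ennreal)" for x
        using suminf_indicator[of "\<lambda>i. A i \<inter> W n" x] by simp
      then have "fiber (indicator ((\<Union>i. A i) \<inter> W n)) g = (\<Sum>i. fiber (indicator (A i \<inter> W n)) g)" for g
        unfolding fiber_def
        by (subst nn_integral_suminf[symmetric]) (auto intro!: nn_integral_cong measurable_mH)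
      then have "at_coset (fiber (indicator ((\<Union>i. A i) \<inter> W n)))
          = (\<lambda>c. \<Sum>i. at_coset (fiber (indicator (A i \<inter> W n))) c)"
        by (auto simp: at_coset_def)
      then show ?case
        using union by simp
    qed
  qed
  have "fiber (indicator A) g = (SUP n. fiber (indicator (A \<inter> W n)) g)" for g
  proof -
    have "(SUP n. fiber (indicator (A \<inter> W n)) g) = (\<integral>\<^sup>+h. (SUP n. indicator (A \<inter> W n) (h \<otimes> g)) \<partial>mH)"
      unfolding fiber_def
    proof (intro nn_integral_monotone_convergence_SUP[symmetric])
      show "incseq (\<lambda>n h. indicator (A \<inter> W n) (h \<otimes> g) :: ennreal)"
        using incseqD[OF W(3)] by (auto simp: incseq_def le_fun_def indicator_def)
    qed (intro measurable_mH, use A in measurable)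
    also have "\<dots> = fiber (indicator A) g"
      unfolding fiber_def
    proof (intro nn_integral_cong)
      fix h
      obtain n where "h \<otimes> g \<in> W n"
        using W(4) by blast
      then have "indicator A (h \<otimes> g) \<le> (SUP n. indicator (A \<inter> W n) (h \<otimes> g) :: ennreal)"
        by (intro SUP_upper2[of n]) (auto simp: indicator_def)
      then show "(SUP n. indicator (A \<inter> W n) (h \<otimes> g) :: ennreal) = indicator A (h \<otimes> g)"
        by (intro antisym SUP_least) (auto simp: indicator_def)
    qed
    finally show ?thesis by simp
  qed
  then have "at_coset (fiber (indicator A)) = (\<lambda>c. SUP n. at_coset (fiber (indicator (A \<inter> W n))) c)"
    by (auto simp: at_coset_def)
  then show ?thesis
    using step by simp
qed

lemma fiber_SUP:
  assumes "\<And>i. U i \<in> borel_measurable borel" "incseq U"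
  shows "fiber (SUP i. U i) = (\<lambda>g. SUP i. fiber (U i) g)"
proof
  fix g
  have "fiber (SUP i. U i) g = (\<integral>\<^sup>+h. (SUP i. U i (h \<otimes> g)) \<partial>mH)"
    by (simp add: fiber_def image_comp)
  also have "\<dots> = (SUP i. fiber (U i) g)"
    unfolding fiber_def using assms
    by (intro nn_integral_monotone_convergence_SUP measurable_mH) (auto simp: incseq_def le_fun_def)
  finally show "fiber (SUP i. U i) g = (SUP i. fiber (U i) g)" .
qed

lemma fiber_cmult:
  assumes [measurable]: "u \<in> borel_measurable borel"
  shows "fiber (\<lambda>x. c * u x) g = c * fiber u g"
  unfolding fiber_def by (intro nn_integral_cmult measurable_mH) measurable

lemma fiber_add:
  assumes [measurable]: "u \<in> borel_measurable borel" "v \<in> borel_measurable borel"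
  shows "fiber (\<lambda>x. u x + v x) g = fiber u g + fiber v g"
  unfolding fiber_def by (intro nn_integral_add measurable_mH) measurable

lemma fiber_measurable:
  assumes "w \<in> borel_measurable borel"
  shows "at_coset (fiber w) \<in> borel_measurable mQ"
  using assms
proof (induction rule: borel_measurable_induct)
  case (cong f g)
  then show ?case
    by (metis (no_types, lifting) UNIV_I ext space_borel)
next
  case (set A)
  then show ?case
    by (rule fiber_set_measurable)
next
  case (mult u c)
  have "at_coset (fiber (\<lambda>x. c * u x)) = (\<lambda>a. c * at_coset (fiber u) a)"
    using mult by (auto simp: at_coset_def fiber_cmult)
  then show ?case
    using mult by simp
next
  case (add u v)
  have "at_coset (fiber (\<lambda>x. v x + u x)) = (\<lambda>a. at_coset (fiber v) a + at_coset (fiber u) a)"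
    using add by (auto simp: at_coset_def fiber_add)
  then show ?case
    using add by simp
next
  case (seq U)
  have "at_coset (fiber (SUP i. U i)) = (\<lambda>c. SUP i. at_coset (fiber (U i)) c)"
    using seq by (auto simp: at_coset_def fiber_SUP)
  then show ?case
    using seq.IH by (simp only:) measurable
qed

section \<open>Weil's integration formula\<close>

lemma fiber_zero_or_mem: "fiber w g \<noteq> 0 \<Longrightarrow> \<exists>h\<in>H. w (h \<otimes> g) \<noteq> 0"
proof (rule ccontr)
  assume "fiber w g \<noteq> 0" "\<not> (\<exists>h\<in>H. w (h \<otimes> g) \<noteq> 0)"
  moreover from this have "fiber w g = (\<integral>\<^sup>+h. 0 \<partial>mH)"
    unfolding fiber_def by (intro nn_integral_cong) auto
  ultimately show False by simp
qed

text \<open>The defining property of the quotient measure is applied to Urysohn functions below the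
  indicator of U. Dominated convergence then acts three times: on G and along the cosets with the
  indicator of U as bound, and on the quotient with a multiple of the indicator of the image of K,
  which has finite measure.\<close>

lemma weil_open:
  assumes U: "open U" and K: "compact K" "U \<subseteq> K"
  shows "emeasure mG U = (\<integral>\<^sup>+c. at_coset (fiber (indicator U)) c \<partial>mQ)"
proof -
  have [measurable]: "U \<in> sets borel" "K \<in> sets borel"
    using U K by (auto simp: borel_compact)
  obtain u :: "nat \<Rightarrow> 'g \<Rightarrow> real" where u: "\<And>n. continuous_on UNIV (u n)" "\<And>n x. 0 \<le> u n x"
    "\<And>n x. u n x \<le> indicator U x" "\<And>x. (\<lambda>n. u n x) \<longlonglongrightarrow> indicator U x"
    using open_indicator_limit_continuous[OF U] by blast
  have u_meas [measurable]: "u n \<in> borel_measurable borel" for n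
    using u(1) by (rule borel_measurable_continuous_onI)
  obtain M where M: "M < \<infinity>" "\<And>g. fiber (indicator K) g \<le> M"
    using fiber_compact_bounded[OF K(1)] by blast
  have fiber_U_le: "fiber (indicator U) g \<le> fiber (indicator K) g" for g
    unfolding fiber_def using K(2) by (intro nn_integral_mono) (auto simp: indicator_def)
  \<comment> \<open>The real coset integral, as in the defining property of the quotient measure.
    Below the indicator of U all values are finite and it agrees with \<open>fiber\<close>.\<close>
  define r where "r w g = (LINT h|mH. w (h \<otimes> g))" for w :: "'g \<Rightarrow> real" and g
  have int_U: "integrable mH (\<lambda>h. indicator U (h \<otimes> g) :: real)" for g
  proof (rule integrableI_bounded)
    have "(\<integral>\<^sup>+h. ennreal (norm (indicator U (h \<otimes> g) :: real)) \<partial>mH) = fiber (indicator U) g"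
      unfolding fiber_def by (intro nn_integral_cong) (auto simp: indicator_def)
    also have "\<dots> < \<infinity>"
      using fiber_U_le M by (meson le_less_trans)
    finally show "(\<integral>\<^sup>+h. ennreal (norm (indicator U (h \<otimes> g) :: real)) \<partial>mH) < \<infinity>" .
  qed (intro measurable_mH, measurable)
  have r_fiber: "ennreal (r w g) = fiber (\<lambda>x. ennreal (w x)) g"
    if [measurable]: "w \<in> borel_measurable borel" and "\<And>x. 0 \<le> w x" "\<And>x. w x \<le> indicator U x" for w g
    unfolding r_def fiber_def using that(2,3)
    by (intro nn_integral_eq_integral[symmetric] Bochner_Integration.integrable_bound[OF int_U[of g]])
       (auto intro!: measurable_mH)
  have r_meas: "at_coset (r w) \<in> borel_measurable mQ"
    if [measurable]: "w \<in> borel_measurable borel" and "\<And>x. 0 \<le> w x" "\<And>x. w x \<le> indicator U x" for w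
  proof -
    have "r w g = enn2real (fiber (\<lambda>x. ennreal (w x)) g)" for g
      using r_fiber[OF that, of g] that(2) by (metis Bochner_Integration.integral_nonneg enn2real_ennreal r_def)
    then have "at_coset (r w) = (\<lambda>c. enn2real (at_coset (fiber (\<lambda>x. ennreal (w x))) c))"
      by (auto simp: at_coset_def)
    then show ?thesis
      using fiber_measurable[of "\<lambda>x. ennreal (w x)"] by simp
  qed
  have r_nonneg: "0 \<le> r w g" if "\<And>x. 0 \<le> w x" for w g
    unfolding r_def using that by (intro Bochner_Integration.integral_nonneg)
  have r_le: "r w g \<le> r (indicator U) g"
    if [measurable]: "w \<in> borel_measurable borel" and "\<And>x. 0 \<le> w x" "\<And>x. w x \<le> indicator U x" for w g
    unfolding r_def using that(2,3)
    by (intro integral_mono Bochner_Integration.integrable_bound[OF int_U[of g]] int_U)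
       (auto intro!: measurable_mH)
  have ind_meas: "(indicator U :: 'g \<Rightarrow> real) \<in> borel_measurable borel" by measurable
  have ind_ennreal: "(\<lambda>x. ennreal (indicator U x)) = indicator U"
    by (auto simp: indicator_def)
  \<comment> \<open>A nonzero coset integral means that the coset meets U and thus belongs to the
    image of K; the constant M is uniform over the cosets.\<close>
  have r_U_bound: "r (indicator U) g \<le> enn2real M * indicator (proj ` K) (proj g)" for g
  proof -
    have e: "ennreal (r (indicator U) g) = fiber (indicator U) g"
      using r_fiber[OF ind_meas, of g] by (simp add: ind_ennreal)
    show ?thesis
    proof (cases "fiber (indicator U) g = 0")
      case True
      with e have "r (indicator U) g \<le> 0" by (metis ennreal_eq_0_iff)
      then show ?thesis
        by (meson enn2real_nonneg indicator_pos_le mult_nonneg_nonneg order_trans)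
    next
      case False
      then obtain h where h: "h \<in> H" "h \<otimes> g \<in> U"
        using fiber_zero_or_mem by (metis indicator_simps(2))
      then have "proj g \<in> proj ` K"
        using K(2) by (metis (no_types, lifting) image_eqI proj_mult subsetD)
      moreover have "r (indicator U) g \<le> enn2real M"
        using e fiber_U_le[of g] M by (metis enn2real_ennreal enn2real_mono infinity_ennreal_def
          indicator_pos_le order_trans r_nonneg)
      ultimately show ?thesis by simp
    qed
  qed
  have int_bound: "integrable mQ (\<lambda>c. enn2real M * indicator (proj ` K) c :: real)"
    using proj_image_compact_sets[OF K(1)] mQ_finite_on_compact[OF compactin_proj_image[OF K(1)]]
    by (intro integrable_mult_right integrable_real_indicator) auto
  have bound_c: "norm (at_coset (r w) c) \<le> enn2real M * indicator (proj ` K) c"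
    if "w \<in> borel_measurable borel" "\<And>x. 0 \<le> w x" "\<And>x. w x \<le> indicator U x" "c \<in> space mQ" for w c
  proof -
    obtain g where c: "c = proj g"
      using \<open>c \<in> space mQ\<close> by auto
    let ?k = "SOME k. k \<in> proj g"
    have "?k \<in> proj g"
      using mem_proj_iff by (metis someI)
    then have k: "proj ?k = proj g"
      by (simp add: mem_proj_iff)
    have "0 \<le> r w ?k" "r w ?k \<le> r (indicator U) ?k"
      using r_nonneg[of w] r_le[of w] that(1-3) by blast+
    with r_U_bound[of ?k] k show ?thesis
      unfolding at_coset_def c by simp
  qed
  have eq: "(LINT g|mG. u n g) = (LINT c|mQ. at_coset (r (u n)) c)" for n
  proof -
    have "(\<lambda>g. complex_of_real (u n g)) \<in> Cc euclidean"
    proof -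
      have "{x. u n x \<noteq> 0} \<subseteq> K"
      proof
        fix x assume "x \<in> {x. u n x \<noteq> 0}"
        then show "x \<in> K"
          using u(2,3)[of n x] K(2) by (cases "x \<in> U") auto
      qed
      then have "compact (closure {x. u n x \<noteq> 0})"
        using K(1) by (metis closed_closure closure_minimal compact_Int_closed compact_imp_closed inf.absorb_iff2)
      then show ?thesis
        using u(1)[of n] by (auto simp: Cc_def intro!: continuous_intros)
    qed
    then have "(LINT g|mG. complex_of_real (u n g))
        = (LINT c|mQ. at_coset (\<lambda>g. LINT h|mH. complex_of_real (u n (h \<otimes> g))) c)"
      using mQ unfolding quotient_measure_def by blast
    also have "(\<lambda>c. at_coset (\<lambda>g. LINT h|mH. complex_of_real (u n (h \<otimes> g))) c)
        = (\<lambda>c. complex_of_real (at_coset (r (u n)) c))"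
      by (simp add: at_coset_def r_def)
    finally have "complex_of_real (LINT g|mG. u n g) = complex_of_real (LINT c|mQ. at_coset (r (u n)) c)"
      by simp
    then show ?thesis
      by (simp only: of_real_eq_iff)
  qed
  have fin_U: "emeasure mG U < \<infinity>"
    using haar_finite_on_compact[OF K(1)] emeasure_mono[of U K mG] K(2) by (simp add: le_less_trans)
  have "(\<lambda>n. LINT g|mG. u n g) \<longlonglongrightarrow> (LINT g|mG. indicator U g)"
    using u fin_U by (intro integral_dominated_convergence[where w = "indicator U"]) auto
  moreover have lim_Q: "integrable mQ (\<lambda>c. at_coset (r (indicator U)) c)"
    "(\<lambda>n. LINT c|mQ. at_coset (r (u n)) c) \<longlonglongrightarrow> (LINT c|mQ. at_coset (r (indicator U)) c)"
  proof -
    have pt: "AE c in mQ. (\<lambda>n. at_coset (r (u n)) c) \<longlonglongrightarrow> at_coset (r (indicator U)) c"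
      unfolding at_coset_def r_def
    proof (intro AE_I2)
      fix c :: "'g set"
      let ?g = "SOME g. g \<in> c"
      show "(\<lambda>n. LINT h|mH. u n (h \<otimes> ?g)) \<longlonglongrightarrow> (LINT h|mH. indicator U (h \<otimes> ?g))"
        using u int_U[of ?g]
        by (intro integral_dominated_convergence[where w = "\<lambda>h. indicator U (h \<otimes> ?g)"])
           (auto intro!: measurable_mH)
    qed
    have bd: "AE c in mQ. norm (at_coset (r (u n)) c) \<le> enn2real M * indicator (proj ` K) c" for n
      using bound_c[OF u_meas u(2,3)] by (intro AE_I2)
    have m: "at_coset (r (indicator U)) \<in> borel_measurable mQ" "\<And>n. at_coset (r (u n)) \<in> borel_measurable mQ"
      using r_meas[OF ind_meas] r_meas[OF u_meas u(2,3)] by auto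
    show "integrable mQ (\<lambda>c. at_coset (r (indicator U)) c)"
      using m pt bd int_bound by (intro integrable_dominated_convergence[OF m int_bound])
    show "(\<lambda>n. LINT c|mQ. at_coset (r (u n)) c) \<longlonglongrightarrow> (LINT c|mQ. at_coset (r (indicator U)) c)"
      by (intro integral_dominated_convergence[OF m int_bound] pt bd)
  qed
  ultimately have "(LINT g|mG. indicator U g) = (LINT c|mQ. at_coset (r (indicator U)) c)"
    using LIMSEQ_unique by (simp add: eq)
  moreover have "emeasure mG U = ennreal (LINT g|mG. indicator U g)"
    using fin_U by (simp add: emeasure_eq_ennreal_measure)
  moreover have "(\<integral>\<^sup>+c. at_coset (fiber (indicator U)) c \<partial>mQ) = (\<integral>\<^sup>+c. ennreal (at_coset (r (indicator U)) c) \<partial>mQ)"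
    using r_fiber[OF ind_meas] by (simp add: at_coset_def ind_ennreal)
  moreover have "(\<integral>\<^sup>+c. ennreal (at_coset (r (indicator U)) c) \<partial>mQ)
      = ennreal (LINT c|mQ. at_coset (r (indicator U)) c)"
    using lim_Q(1) r_nonneg by (intro nn_integral_eq_integral) (auto simp: at_coset_def)
  ultimately show ?thesis by simp
qed

text \<open>Both sides are measures in A. They agree on the relatively compact open sets, which are
  stable under intersection and generate the Borel sets; the W n exhaust the group by such sets of
  finite measure, so the two measures coincide.\<close>

lemma weil_set:
  assumes A: "A \<in> sets borel"
  shows "emeasure mG A = (\<integral>\<^sup>+c. at_coset (fiber (indicator A)) c \<partial>mQ)"
proof -
  obtain W :: "nat \<Rightarrow> 'g set" where W: "\<And>n. open (W n)" "\<And>n. compact (closure (W n))"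
      "incseq W" "(\<Union>n. W n) = UNIV"
    using exhaustion by blast
  define \<nu> where "\<nu> = measure_of UNIV (sets borel) (\<lambda>A. \<integral>\<^sup>+c. at_coset (fiber (indicator A)) c \<partial>mQ)"
  have sets_\<nu> [simp]: "sets \<nu> = sets borel"
    unfolding \<nu>_def using sets.sigma_sets_eq[of "borel :: 'g measure"] by (simp add: sets_measure_of_conv)
  have \<nu>: "emeasure \<nu> A = (\<integral>\<^sup>+c. at_coset (fiber (indicator A)) c \<partial>mQ)" if "A \<in> sets borel" for A
  proof (rule emeasure_measure_of[OF \<nu>_def])
    show "positive (sets \<nu>) (\<lambda>A. \<integral>\<^sup>+c. at_coset (fiber (indicator A)) c \<partial>mQ)"
      by (simp add: positive_def at_coset_def fiber_def)
    show "countably_additive (sets \<nu>) (\<lambda>A. \<integral>\<^sup>+c. at_coset (fiber (indicator A)) c \<partial>mQ)"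
    proof (rule countably_additiveI)
      fix A :: "nat \<Rightarrow> 'g set" assume A: "range A \<subseteq> sets \<nu>" "disjoint_family A"
      have [measurable]: "A i \<in> sets borel" for i
        using A(1) by auto
      have "fiber (indicator (\<Union>i. A i)) g = (\<Sum>i. fiber (indicator (A i)) g)" for g
        unfolding fiber_def using suminf_indicator[OF A(2)]
        by (subst nn_integral_suminf[symmetric]) (auto intro!: nn_integral_cong measurable_mH)
      then have "at_coset (fiber (indicator (\<Union>i. A i))) = (\<lambda>c. \<Sum>i. at_coset (fiber (indicator (A i))) c)"
        by (auto simp: at_coset_def)
      then show "(\<Sum>i. \<integral>\<^sup>+c. at_coset (fiber (indicator (A i))) c \<partial>mQ)
          = (\<integral>\<^sup>+c. at_coset (fiber (indicator (\<Union>i. A i))) c \<partial>mQ)"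
        by (simp add: nn_integral_suminf fiber_set_measurable)
    qed
  qed (use that in auto)
  have "mG = \<nu>"
  proof (rule measure_eqI_generator_eq)
    let ?E = "{U. open U \<and> (\<exists>K. compact K \<and> U \<subseteq> K)} :: 'g set set"
    show "Int_stable ?E"
      unfolding Int_stable_def by (auto intro: le_infI1)
    show "?E \<subseteq> Pow UNIV" by simp
    show "emeasure mG U = emeasure \<nu> U" if "U \<in> ?E" for U
      using that weil_open by (auto simp: \<nu>)
    have "sigma_sets UNIV ?E = sets borel"
    proof
      show "sigma_sets UNIV ?E \<subseteq> sets borel"
        by (rule sets.sigma_sets_subset'[of ?E borel UNIV, simplified]) auto
      have "U \<in> sigma_sets UNIV ?E" if "open U" for U
      proof -
        have "U \<inter> W n \<in> ?E" for n
        proof -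
          have "U \<inter> W n \<subseteq> closure (W n)"
            using closure_subset by blast
          then show ?thesis
            using W(1,2) that by blast
        qed
        then have "(\<Union>n. U \<inter> W n) \<in> sigma_sets UNIV ?E"
          by (intro sigma_sets.Union sigma_sets.Basic)
        moreover have "(\<Union>n. U \<inter> W n) = U"
          using W(4) by blast
        ultimately show ?thesis by simp
      qed
      then show "sets borel \<subseteq> sigma_sets UNIV ?E"
        unfolding sets_borel by (intro sigma_sets_mono) auto
    qed
    then show "sets mG = sigma_sets UNIV ?E" "sets \<nu> = sigma_sets UNIV ?E"
      by auto
    show "range W \<subseteq> ?E"
      using W(1,2) closure_subset by blast
    show "(\<Union>i. W i) = UNIV" by fact
    show "emeasure mG (W i) \<noteq> \<infinity>" for i
      using haar_finite_on_compact[OF W(2), of i] emeasure_mono[of "W i" "closure (W i)" mG] closure_subset[of "W i"]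
      by auto
  qed
  then show ?thesis
    using \<nu>[OF A] by simp
qed

lemma weil:
  assumes "w \<in> borel_measurable borel"
  shows "(\<integral>\<^sup>+g. w g \<partial>mG) = (\<integral>\<^sup>+c. at_coset (fiber w) c \<partial>mQ)"
  using assms
proof (induction rule: borel_measurable_induct)
  case (cong f g)
  then show ?case
    by (metis (no_types, lifting) UNIV_I ext space_borel)
next
  case (set A)
  then show ?case
    using weil_set by simp
next
  case (mult u c)
  have "at_coset (fiber (\<lambda>x. c * u x)) = (\<lambda>a. c * at_coset (fiber u) a)"
    using mult by (auto simp: at_coset_def fiber_cmult)
  then show ?case
    using mult by (simp add: nn_integral_cmult fiber_measurable)
next
  case (add u v)
  have "at_coset (fiber (\<lambda>x. v x + u x)) = (\<lambda>a. at_coset (fiber v) a + at_coset (fiber u) a)"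
    using add by (auto simp: at_coset_def fiber_add)
  then show ?case
    using add by (simp add: nn_integral_add fiber_measurable)
next
  case (seq U)
  have "at_coset (fiber (SUP i. U i)) = (\<lambda>c. SUP i. at_coset (fiber (U i)) c)"
    using seq by (auto simp: at_coset_def fiber_SUP)
  moreover have "(\<integral>\<^sup>+c. (SUP i. at_coset (fiber (U i)) c) \<partial>mQ) = (SUP i. \<integral>\<^sup>+c. at_coset (fiber (U i)) c \<partial>mQ)"
    using seq by (intro nn_integral_monotone_convergence_SUP fiber_measurable)
      (auto simp: incseq_def le_fun_def at_coset_def fiber_def intro!: nn_integral_mono)
  moreover have "(SUP i. U i) = (\<lambda>g. SUP i. U i g)"
    by (auto simp: fun_eq_iff image_comp)
  moreover have "(\<integral>\<^sup>+g. (SUP i. U i g) \<partial>mG) = (SUP i. \<integral>\<^sup>+g. U i g \<partial>mG)"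
    using seq by (intro nn_integral_monotone_convergence_SUP) auto
  ultimately show ?case
    using seq.IH by simp
qed

section \<open>Invariant functions descend to the homogeneous space\<close>

text \<open>The factor may be infinite; the convention \<infinity> * 0 = 0 in \<open>ennreal\<close>
  keeps the formula correct off A.\<close>

lemma fiber_invariant_indicator:
  assumes "\<And>a g. a \<in> H \<Longrightarrow> a \<otimes> g \<in> A \<longleftrightarrow> g \<in> A"
  shows "fiber (indicator A) g = emeasure mH H * indicator A g"
proof -
  have "fiber (indicator A) g = (\<integral>\<^sup>+h. indicator A g \<partial>mH)"
    unfolding fiber_def using assms by (intro nn_integral_cong) (auto simp: indicator_def)
  then show ?thesis
    by (simp add: mult.commute)
qed

text \<open>As H has nonzero measure, the image of A is the set where the coset integral of its
  indicator does not vanish. Measurability of coset integrals thus gives measurability of the image,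
  and Weil's formula sends null sets to null sets.\<close>

lemma invariant_set_descends:
  assumes A: "A \<in> sets borel" and inv: "\<And>a g. a \<in> H \<Longrightarrow> a \<otimes> g \<in> A \<longleftrightarrow> g \<in> A"
  shows "proj ` A \<in> sets mQ"
    and "A \<in> null_sets mG \<Longrightarrow> proj ` A \<in> null_sets mQ"
proof -
  have val: "at_coset (fiber (indicator A)) (proj g) = emeasure mH H * indicator A g" for g
    using fiber_invariant_indicator[OF inv] A by (simp add: at_coset_fiber)
  have mem: "proj g \<in> proj ` A \<longleftrightarrow> g \<in> A" for g
  proof
    assume "proj g \<in> proj ` A"
    then obtain k where "k \<in> A" "proj g = proj k" by blast
    then obtain a where "a \<in> H" "k = a \<otimes> g"
      using proj_eq_iff[of g k] by blast
    with inv[of a g] \<open>k \<in> A\<close> show "g \<in> A" by blast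
  qed blast
  have eq: "proj ` A = {c \<in> space mQ. at_coset (fiber (indicator A)) c \<noteq> 0}"
    using emeasure_mH_H by (auto simp: val mem indicator_def split: if_splits)
  show *: "proj ` A \<in> sets mQ"
    unfolding eq using fiber_set_measurable[OF A] by measurable
  assume "A \<in> null_sets mG"
  then have "(\<integral>\<^sup>+c. at_coset (fiber (indicator A)) c \<partial>mQ) = 0"
    using weil_set[OF A] by auto
  then have "AE c in mQ. at_coset (fiber (indicator A)) c = 0"
    using fiber_set_measurable[OF A] by (simp add: nn_integral_0_iff_AE)
  then show "proj ` A \<in> null_sets mQ"
    unfolding AE_iff_null_sets[OF *] unfolding eq by (elim AE_mp) auto
qed

text \<open>Preimages of measurable sets under f are invariant Borel sets, so their images in the
  quotient are measurable. This handles the arbitrary choice of representatives in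
  \<open>at_coset\<close>.\<close>

lemma invariant_function_descends:
  assumes f: "f \<in> borel \<rightarrow>\<^sub>M N" and inv: "\<And>a g. a \<in> H \<Longrightarrow> f (a \<otimes> g) = f g"
  shows "at_coset f \<in> mQ \<rightarrow>\<^sub>M N"
proof (rule measurableI)
  fix c assume "c \<in> space mQ"
  then show "at_coset f c \<in> space N"
    using measurable_space[OF f] by (auto simp: at_coset_proj inv)
next
  fix B assume B: "B \<in> sets N"
  have "at_coset f -` B \<inter> space mQ = proj ` (f -` B)"
    by (auto simp: at_coset_proj inv)
  then show "at_coset f -` B \<inter> space mQ \<in> sets mQ"
    using invariant_set_descends(1)[of "f -` B"] measurable_sets[OF f B] inv by simp
qed

text \<open>The exceptional set is a null union of cosets, so its image is null; a coset outside
  this image contains good points only, whence the quantifier over all g in c.\<close>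

lemma invariant_AE_descends:
  assumes "AE g in mG. P g" "{g. P g} \<in> sets borel" and inv: "\<And>a g. a \<in> H \<Longrightarrow> P (a \<otimes> g) \<longleftrightarrow> P g"
  shows "AE c in mQ. \<forall>g\<in>c. P g"
proof -
  have "{g. \<not> P g} \<in> sets borel"
    using sets.compl_sets[OF assms(2)] by (simp add: Compl_eq_Diff_UNIV[symmetric] Collect_neg_eq)
  moreover from this have "{g. \<not> P g} \<in> null_sets mG"
    using assms(1) AE_iff_null_sets[of "{g. \<not> P g}" mG] by simp
  ultimately have "proj ` {g. \<not> P g} \<in> null_sets mQ"
    using inv by (intro invariant_set_descends(2)) auto
  then have "AE c in mQ. c \<notin> proj ` {g. \<not> P g}"
    by (rule AE_not_in)
  then show ?thesis
  proof (rule AE_mp, intro AE_I2 impI ballI)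
    fix c g assume "c \<in> space mQ" "c \<notin> proj ` {g. \<not> P g}" "g \<in> c"
    moreover from this have "c = proj g"
      using mem_proj_iff by auto
    ultimately show "P g" by blast
  qed
qed

section \<open>Normalized cutoff functions\<close>

lemma measurable_proj [measurable]: "proj \<in> borel \<rightarrow>\<^sub>M mQ"
proof -
  have "sets mQ = sets (sigma (range proj) {U. openin T U})"
    by (simp add: sets_mQ borel_of_def)
  moreover have "proj \<in> borel \<rightarrow>\<^sub>M sigma (range proj) {U. openin T U}"
  proof (rule measurable_measure_of)
    show "{U. openin T U} \<subseteq> Pow (range proj)"
      using openin_T_iff by auto
    show "proj -` U \<inter> space borel \<in> sets borel" if "U \<in> {U. openin T U}" for U
      using that openin_T_iff by (auto simp: vimage_def)
  qed auto
  ultimately show ?thesis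
    by (subst measurable_cong_sets[OF refl])
qed

text \<open>A factor depending only on the coset leaves the integral over H, so Weil's formula turns
  the weight k upstairs into the density \<open>fiber k\<close> downstairs. Stated for measures,
  this transfers to complex integrands.\<close>

lemma weil_density:
  fixes k :: "'g \<Rightarrow> ennreal"
  assumes [measurable]: "k \<in> borel_measurable borel"
  shows "distr (density mG k) mQ proj = density mQ (at_coset (fiber k))"
proof (rule measure_eqI)
  fix B assume "B \<in> sets (distr (density mG k) mQ proj)"
  then have B [measurable]: "B \<in> sets mQ"
    by simp
  have "emeasure (distr (density mG k) mQ proj) B = (\<integral>\<^sup>+g. k g * indicator B (proj g) \<partial>mG)"
  proof -
    have "proj -` B \<in> sets borel"
      using measurable_sets[OF measurable_proj B] by simp
    moreover have "indicator (proj -` B) g = (indicator B (proj g) :: ennreal)" for g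
      by (simp add: indicator_def)
    ultimately show ?thesis
      by (subst emeasure_distr) (auto simp: emeasure_density)
  qed
  also have "\<dots> = (\<integral>\<^sup>+c. at_coset (fiber (\<lambda>g. k g * indicator B (proj g))) c \<partial>mQ)"
    by (rule weil) measurable
  also have "\<dots> = (\<integral>\<^sup>+c. at_coset (fiber k) c * indicator B c \<partial>mQ)"
  proof (rule nn_integral_cong)
    fix c assume "c \<in> space mQ"
    then obtain g where c: "c = proj g" by auto
    have "fiber (\<lambda>g. k g * indicator B (proj g)) g = (\<integral>\<^sup>+h. k (h \<otimes> g) * indicator B (proj g) \<partial>mH)"
      unfolding fiber_def by (intro nn_integral_cong) simp
    also have "\<dots> = fiber k g * indicator B (proj g)"
      unfolding fiber_def by (intro nn_integral_multc measurable_mH) measurable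
    finally have "fiber (\<lambda>g. k g * indicator B (proj g)) g = fiber k g * indicator B (proj g)" .
    then show "at_coset (fiber (\<lambda>g. k g * indicator B (proj g))) c = at_coset (fiber k) c * indicator B c"
      unfolding c by (subst (1 2) at_coset_fiber) measurable
  qed
  also have "\<dots> = emeasure (density mQ (at_coset (fiber k))) B"
    by (subst emeasure_density) (auto intro: fiber_measurable)
  finally show "emeasure (distr (density mG k) mQ proj) B = emeasure (density mQ (at_coset (fiber k))) B" .
qed simp

text \<open>Changes of density and of variable hold for Bochner integrals of all measurable
  functions, so u may be any measurable function. The bound by 1 makes the density finite and hence
  real; where the density differs from 1, u vanishes.\<close>

lemma weil_integral:
  fixes k :: "'g \<Rightarrow> real" and u :: "'g set \<Rightarrow> complex"
  assumes [measurable]: "k \<in> borel_measurable borel" "u \<in> borel_measurable mQ"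
    and k: "\<And>g. 0 \<le> k g" and le: "\<And>g. fiber (\<lambda>g. ennreal (k g)) g \<le> 1"
    and one: "\<And>g. u (proj g) \<noteq> 0 \<Longrightarrow> fiber (\<lambda>g. ennreal (k g)) g = 1"
  shows "(LINT g|mG. k g *\<^sub>R u (proj g)) = (LINT c|mQ. u c)"
proof -
  let ?k = "\<lambda>g. ennreal (k g)"
  have m: "at_coset (fiber ?k) \<in> borel_measurable mQ"
    by (rule fiber_measurable) measurable
  have "at_coset (fiber ?k) = (\<lambda>c. ennreal (enn2real (at_coset (fiber ?k) c)))"
    using le by (auto simp: at_coset_def fun_eq_iff intro!: ennreal_enn2real[symmetric] le_less_trans[OF le])
  then have d: "density mQ (at_coset (fiber ?k)) = density mQ (\<lambda>c. ennreal (enn2real (at_coset (fiber ?k) c)))"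
    by simp
  have "(LINT g|mG. k g *\<^sub>R u (proj g)) = (LINT g|density mG ?k. u (proj g))"
    using k by (intro integral_density[symmetric]) auto
  also have "\<dots> = (LINT c|distr (density mG ?k) mQ proj. u c)"
    by (intro integral_distr[symmetric]) auto
  also have "\<dots> = (LINT c|density mQ (\<lambda>c. ennreal (enn2real (at_coset (fiber ?k) c))). u c)"
    by (subst weil_density) (auto simp: d[symmetric])
  also have "\<dots> = (LINT c|mQ. enn2real (at_coset (fiber ?k) c) *\<^sub>R u c)"
    using m by (intro integral_density) auto
  also have "\<dots> = (LINT c|mQ. u c)"
  proof (rule Bochner_Integration.integral_cong[OF refl])
    fix c assume "c \<in> space mQ"
    then obtain g where c: "c = proj g" by auto
    have "at_coset (fiber ?k) c = fiber ?k g"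
      unfolding c by (rule at_coset_fiber) measurable
    then show "enn2real (at_coset (fiber ?k) c) *\<^sub>R u c = u c"
      using one[of g] c by (cases "u c = 0") auto
  qed
  finally show ?thesis .
qed

text \<open>Let the compact K0 project onto a set containing L, let W n \<inter> H have positive
  measure \<delta>, and let K be the product of the closure of W n with K0. A coset over L contains
  some k in K0, and K contains W n k, so the coset integral e of the indicator of K is at least
  \<delta> over L. Since e is constant on cosets, division by e normalizes.\<close>

lemma fiber_cutoff:
  assumes L: "compactin T L"
  obtains k :: "'g \<Rightarrow> real" and K C
  where "k \<in> borel_measurable borel" "\<And>g. 0 \<le> k g" "\<And>g. k g \<le> C"
    "compact K" "\<And>g. g \<notin> K \<Longrightarrow> k g = 0"
    "\<And>g. fiber (\<lambda>g. ennreal (k g)) g \<le> 1" "\<And>g. proj g \<in> L \<Longrightarrow> fiber (\<lambda>g. ennreal (k g)) g = 1"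
proof -
  obtain W :: "nat \<Rightarrow> 'g set" where W: "\<And>n. open (W n)" "\<And>n. compact (closure (W n))"
      "incseq W" "(\<Union>n. W n) = UNIV"
    using exhaustion by blast
  obtain K0 where K0: "compact K0" "L \<subseteq> proj ` K0"
    using compactin_subset_proj_image[OF L] by blast
  have WH: "W n \<inter> H \<in> sets mH" for n
    unfolding sets_mH sets_restrict_space using W(1) by (intro image_eqI[of _ _ "W n"]) auto
  have "\<exists>n. emeasure mH (W n \<inter> H) \<noteq> 0"
  proof (rule ccontr)
    assume "\<nexists>n. emeasure mH (W n \<inter> H) \<noteq> 0"
    then have "emeasure mH (\<Union>n. W n \<inter> H) = 0"
      using WH by (intro emeasure_UN_eq_0) auto
    moreover have "(\<Union>n. W n \<inter> H) = H"
      using W(4) by auto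
    ultimately show False
      using emeasure_mH_H by simp
  qed
  then obtain n where n: "emeasure mH (W n \<inter> H) \<noteq> 0" by blast
  define \<delta> where "\<delta> = emeasure mH (W n \<inter> H)"
  define K where "K = (\<lambda>p. fst p \<otimes> snd p) ` (closure (W n) \<times> K0)"
  have K: "compact K"
    unfolding K_def by (intro compact_mult_image W K0)
  have [measurable]: "K \<in> sets borel"
    using K by (simp add: borel_compact)
  define e where "e = fiber (indicator K)"
  have e_meas [measurable]: "e \<in> borel_measurable borel"
  proof -
    have "e = (\<lambda>g. at_coset e (proj g))"
      unfolding e_def by (subst at_coset_fiber) auto
    moreover have "at_coset e \<in> borel_measurable mQ"
      unfolding e_def by (rule fiber_measurable) measurable
    ultimately show ?thesis
      by (metis measurable_compose measurable_proj)
  qed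
  obtain M where M: "M < \<infinity>" "\<And>g. e g \<le> M"
    using fiber_compact_bounded[OF K] unfolding e_def by blast
  have e_fin: "e g < \<infinity>" for g
    using M by (meson le_less_trans)
  have e_inv: "e (a \<otimes> g) = e g" if "a \<in> H" for a g
    unfolding e_def using that by (intro fiber_mult) auto
  have e_lower: "\<delta> \<le> e g" if gL: "proj g \<in> L" for g
  proof -
    obtain k where k: "k \<in> K0" "proj g = proj k"
      using gL K0(2) by blast
    then obtain a where a: "a \<in> H" "k = a \<otimes> g"
      using proj_eq_iff[of g k] by blast
    have "\<delta> = (\<integral>\<^sup>+h. indicator (W n \<inter> H) h \<partial>mH)"
      unfolding \<delta>_def using WH by simp
    also have "\<dots> \<le> e k"
      unfolding e_def fiber_def
    proof (rule nn_integral_mono)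
      fix h
      have "h \<otimes> k \<in> K" if "h \<in> W n"
        unfolding K_def using that k(1) closure_subset[of "W n"] by (intro image_eqI[of _ _ "(h, k)"]) auto
      then show "indicator (W n \<inter> H) h \<le> (indicator K (h \<otimes> k) :: ennreal)"
        by (auto simp: indicator_def)
    qed
    finally show ?thesis
      using a e_inv by simp
  qed
  have \<delta>: "0 < \<delta>" "\<delta> < \<infinity>"
  proof -
    show "0 < \<delta>"
      using n unfolding \<delta>_def by (simp add: zero_less_iff_neq_zero)
    have "emeasure mH (closure (W n) \<inter> H) < \<infinity>"
      by (intro mH_finite_on_compact compact_Int_closed W H_closed) auto
    moreover have "closure (W n) \<inter> H \<in> sets mH"
      unfolding sets_mH sets_restrict_space by (intro image_eqI[of _ _ "closure (W n)"]) auto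
    ultimately show "\<delta> < \<infinity>"
      unfolding \<delta>_def using emeasure_mono[of "W n \<inter> H" "closure (W n) \<inter> H" mH] closure_subset[of "W n"]
      by (metis Int_mono le_less_trans subset_refl)
  qed
  \<comment> \<open>The threshold \<delta>, rather than e \<noteq> 0, keeps k bounded by 1 /
    \<delta>. The condition is constant on cosets, so k integrates to exactly 1 or 0 along each of
    them.\<close>
  define k where "k g = (if \<delta> \<le> e g then indicator K g / enn2real (e g) else 0)" for g
  show ?thesis
  proof
    show k_meas [measurable]: "k \<in> borel_measurable borel"
      unfolding k_def[abs_def] by measurable
    show k_nonneg: "0 \<le> k g" for g
      by (simp add: k_def)
    show "k g \<le> 1 / enn2real \<delta>" for g
    proof (cases "\<delta> \<le> e g")
      case True
      then have "0 < enn2real \<delta>" "enn2real \<delta> \<le> enn2real (e g)"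
        using \<delta> e_fin[of g] by (auto simp: enn2real_positive_iff intro: enn2real_mono)
      then show ?thesis
        unfolding k_def using True by (auto simp: indicator_def intro: divide_left_mono)
    qed (simp add: k_def)
    show "compact K" by fact
    show "k g = 0" if "g \<notin> K" for g
      using that by (simp add: k_def)
    have fiber_k: "fiber (\<lambda>g. ennreal (k g)) g = (if \<delta> \<le> e g then 1 else 0)" for g
    proof (cases "\<delta> \<le> e g")
      case True
      then have "0 < enn2real (e g)"
        using \<delta> e_fin[of g] by (auto simp: enn2real_positive_iff)
      have "fiber (\<lambda>g. ennreal (k g)) g = (\<integral>\<^sup>+h. indicator K (h \<otimes> g) / e g \<partial>mH)"
        unfolding fiber_def
      proof (rule nn_integral_cong)
        fix h assume "h \<in> space mH"
        then have "k (h \<otimes> g) = indicator K (h \<otimes> g) / enn2real (e g)"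
          using e_inv True by (simp add: k_def)
        then show "ennreal (k (h \<otimes> g)) = indicator K (h \<otimes> g) / e g"
          using \<open>0 < enn2real (e g)\<close> e_fin[of g]
          by (auto simp: indicator_def divide_ennreal[symmetric])
      qed
      also have "\<dots> = (\<integral>\<^sup>+h. indicator K (h \<otimes> g) \<partial>mH) / e g"
        by (intro nn_integral_divide measurable_mH) measurable
      also have "\<dots> = e g / e g"
        by (simp add: e_def fiber_def)
      also have "\<dots> = 1"
        using \<delta>(1) True e_fin[of g] by (intro ennreal_divide_self) auto
      finally show ?thesis
        using True by simp
    next
      case False
      then have "fiber (\<lambda>g. ennreal (k g)) g = (\<integral>\<^sup>+h. 0 \<partial>mH)"
        unfolding fiber_def using e_inv by (intro nn_integral_cong) (simp add: k_def)
      with False show ?thesis by simp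
    qed
    show "fiber (\<lambda>g. ennreal (k g)) g \<le> 1" for g
      by (simp add: fiber_k)
    show "fiber (\<lambda>g. ennreal (k g)) g = 1" if "proj g \<in> L" for g
      using e_lower[OF that] by (simp add: fiber_k)
  qed
qed

end

section \<open>Functions measurable for a completed measure\<close>

lemma measurable_cnj [measurable]: "cnj \<in> borel_measurable borel"
  by (intro borel_measurable_continuous_onI continuous_intros)

text \<open>Preimages under f and g differ by a subset of a null set, which the completion contains.
  This makes the infinite sums and the dual measurable, as each agrees almost everywhere with a
  function known to be measurable.\<close>

lemma measurable_completion_AE:
  assumes f: "f \<in> completion M \<rightarrow>\<^sub>M N" and ae: "AE x in M. f x = g x"
    and g: "\<And>x. x \<in> space M \<Longrightarrow> g x \<in> space N"
  shows "g \<in> completion M \<rightarrow>\<^sub>M N"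
proof (rule measurableI)
  fix B assume B: "B \<in> sets N"
  show "g -` B \<inter> space (completion M) \<in> sets (completion M)"
  proof (rule completion.in_sets_AE)
    show "AE x in completion M. x \<in> f -` B \<inter> space (completion M) \<longleftrightarrow> x \<in> g -` B \<inter> space (completion M)"
      using AE_completion[OF ae] by eventually_elim auto
    show "f -` B \<inter> space (completion M) \<in> sets (completion M)"
      by (rule measurable_sets[OF f B])
  qed auto
qed (use g in auto)

lemma completion_ex_borel_measurable_complex:
  fixes f :: "'a \<Rightarrow> complex"
  assumes "f \<in> borel_measurable (completion M)"
  obtains f' where "f' \<in> borel_measurable M" "AE x in M. f x = f' x"
proof -
  obtain r where r: "r \<in> borel_measurable M" "AE x in M. Re (f x) = r x"
    using completion_ex_borel_measurable_real[of "\<lambda>x. Re (f x)" M] assms by auto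
  obtain i where i: "i \<in> borel_measurable M" "AE x in M. Im (f x) = i x"
    using completion_ex_borel_measurable_real[of "\<lambda>x. Im (f x)" M] assms by auto
  show ?thesis
  proof
    show "(\<lambda>x. Complex (r x) (i x)) \<in> borel_measurable M"
      using r(1) i(1) by (subst borel_measurable_complex_iff) simp
    show "AE x in M. f x = Complex (r x) (i x)"
      using r(2) i(2) by eventually_elim (simp add: complex_eq_iff)
  qed
qed

locale integrable_transverse = homogeneous_pair G mG H mH mQ
  for G :: "('g::{t2_space, second_countable_topology}, 'b) monoid_scheme" (structure)
    and mG H mH mQ +
  fixes X \<mu> \<sigma> :: "'x measure" and act :: "'g \<Rightarrow> 'x \<Rightarrow> 'x" and Y :: "'x set"
  assumes system: "integrable_transverse_system G H X act Y \<mu>"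
    and \<sigma>: "transverse_measure G H mG mH X act Y \<mu> \<sigma>"
begin

abbreviation hit where "hit x \<equiv> hitting_times G H act Y x"

lemma hit_subset: "hit x \<subseteq> range proj"
  by (auto simp: hitting_times_def)

lemma G_space: "standard_borel_G_space G X act" and cross: "cross_section G H X act Y"
  and sets_\<mu> [measurable_cong, simp]: "sets \<mu> = sets X"
  using system by (auto simp: integrable_transverse_system_def transverse_system_def)

lemma space_\<mu> [simp]: "space \<mu> = space X"
  using sets_eq_imp_space_eq[OF sets_\<mu>] .

lemma action: "group_action G (space X) act"
  using G_space by (simp add: standard_borel_G_space_def)

lemma act_space [simp, intro]: "x \<in> space X \<Longrightarrow> act g x \<in> space X"
  using group_action.element_image[OF action] by simp

lemma act_mult: "x \<in> space X \<Longrightarrow> act (g \<otimes> k) x = act g (act k x)"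
  using group_action.composition_rule[OF action] by simp

lemma act_inv_act [simp]: "x \<in> space X \<Longrightarrow> act (inv g) (act g x) = x"
  using group_action.orbit_sym_aux[OF action, of g x] by simp

lemma act_act_inv [simp]: "x \<in> space X \<Longrightarrow> act g (act (inv g) x) = x"
  using act_inv_act[of x "inv g"] by simp

lemma measurable_act [measurable (raw)]:
  assumes "f \<in> borel_measurable M" "k \<in> M \<rightarrow>\<^sub>M X"
  shows "(\<lambda>x. act (f x) (k x)) \<in> M \<rightarrow>\<^sub>M X"
proof -
  have "(\<lambda>(g, x). act g x) \<in> borel \<Otimes>\<^sub>M X \<rightarrow>\<^sub>M X"
    using G_space by (simp add: standard_borel_G_space_def)
  from measurable_compose[OF measurable_Pair[OF assms] this] show ?thesis
    by simp
qed

lemma Y_sets [measurable]: "Y \<in> sets X"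
  using cross by (simp add: cross_section_def)

lemma Y_space: "y \<in> Y \<Longrightarrow> y \<in> space X"
  using sets.sets_into_space[OF Y_sets] by blast

lemma act_Y: "h \<in> H \<Longrightarrow> y \<in> Y \<Longrightarrow> act h y \<in> Y"
  using cross unfolding cross_section_def by blast

lemma finite_\<sigma>: "finite_measure \<sigma>" and sets_\<sigma>: "sets \<sigma> = sets (restrict_space X Y)"
  and distr_\<sigma>: "h \<in> H \<Longrightarrow> distr \<sigma> \<sigma> (act h) = \<sigma>"
  using \<sigma> by (auto simp: transverse_measure_def)

sublocale \<sigma>: finite_measure \<sigma>
  by (rule finite_\<sigma>)

lemma space_\<sigma> [simp]: "space \<sigma> = Y"
  using sets_eq_imp_space_eq[OF sets_\<sigma>] Y_space by (auto simp: space_restrict_space)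

lemma measurable_\<sigma>: "f \<in> X \<rightarrow>\<^sub>M N \<Longrightarrow> f \<in> \<sigma> \<rightarrow>\<^sub>M N"
  unfolding measurable_cong_sets[OF sets_\<sigma> refl] by (rule measurable_restrict_space1)

lemma measurable_\<sigma>_id [measurable]: "(\<lambda>y. y) \<in> \<sigma> \<rightarrow>\<^sub>M X"
  by (rule measurable_\<sigma>) measurable

lemma measurable_act_\<sigma>: "h \<in> H \<Longrightarrow> act h \<in> \<sigma> \<rightarrow>\<^sub>M \<sigma>"
  unfolding measurable_cong_sets[OF refl sets_\<sigma>]
  by (intro measurable_restrict_space2) (auto simp: act_Y)

section \<open>Counting hitting times\<close>

text \<open>A finite integral forces the counting function to be finite almost everywhere, where the
  real-valued cardinality represents it.\<close>

lemma hits_compact: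
  assumes L: "compactin T L"
  shows "AE x in \<mu>. finite (hit x \<inter> L)"
    and "(\<lambda>x. real (card (hit x \<inter> L))) \<in> borel_measurable (completion \<mu>)"
    and "integrable (completion \<mu>) (\<lambda>x. real (card (hit x \<inter> L)))"
    and "{x \<in> space \<mu>. finite (hit x \<inter> L)} \<in> sets (completion \<mu>)"
proof -
  let ?N = "\<lambda>x. emeasure (count_space UNIV) (hit x \<inter> L)"
  have N [measurable]: "?N \<in> borel_measurable (completion \<mu>)" and fin: "(\<integral>\<^sup>+x. ?N x \<partial>completion \<mu>) < \<infinity>"
    using system L by (auto simp: integrable_transverse_system_def)
  have "AE x in completion \<mu>. ?N x \<noteq> \<infinity>"
    using fin by (intro nn_integral_PInf_AE[OF N]) auto
  then show "AE x in \<mu>. finite (hit x \<inter> L)"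
    unfolding AE_completion_iff by (rule AE_mp) (auto simp: emeasure_count_space)
  \<comment> \<open>True for infinite sets as well: \<open>card\<close> and \<open>enn2real\<close>
    both return the default value 0.\<close>
  have "real (card (hit x \<inter> L)) = enn2real (?N x)" for x
    by (simp add: emeasure_count_space)
  then show m: "(\<lambda>x. real (card (hit x \<inter> L))) \<in> borel_measurable (completion \<mu>)"
    by simp
  have "(\<integral>\<^sup>+x. ennreal (norm (real (card (hit x \<inter> L)))) \<partial>completion \<mu>) \<le> (\<integral>\<^sup>+x. ?N x \<partial>completion \<mu>)"
    by (intro nn_integral_mono) (auto simp: emeasure_count_space ennreal_of_nat_eq_real_of_nat)
  with fin m show "integrable (completion \<mu>) (\<lambda>x. real (card (hit x \<inter> L)))"
    by (intro integrableI_bounded) auto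
  have "{x \<in> space \<mu>. finite (hit x \<inter> L)} = {x \<in> space (completion \<mu>). ?N x \<noteq> \<infinity>}"
    by (auto simp: emeasure_count_space)
  also have "\<dots> \<in> sets (completion \<mu>)"
    by measurable
  finally show "{x \<in> space \<mu>. finite (hit x \<inter> L)} \<in> sets (completion \<mu>)" .
qed

text \<open>
  The layer-cake sums \<open>(\<Sum>k. indicator {u \<ge> k/m}) / m\<close> converge to \<open>u\<close>, and the superlevel sets are
  compact, so that measurability reduces to that of the counting functions.
\<close>

lemma sum_hits_measurable:
  fixes u :: "'g set \<Rightarrow> real"
  assumes L: "compactin T L" and sub: "\<And>t. t > 0 \<Longrightarrow> compactin T {c \<in> range proj. t \<le> u c}"
    and supp: "\<And>c. c \<in> range proj \<Longrightarrow> u c \<noteq> 0 \<Longrightarrow> c \<in> L"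
    and u: "\<And>c. c \<in> range proj \<Longrightarrow> 0 \<le> u c" "\<And>c. c \<in> range proj \<Longrightarrow> u c \<le> M"
  shows "(\<lambda>x. \<Sum>c\<in>hit x \<inter> L. u c) \<in> borel_measurable (completion \<mu>)"
proof -
  \<comment> \<open>An integer bound on u: the levels k / (n + 1) with k up to (n + 1) B exhaust its
    range for every n.\<close>
  obtain B :: nat where B: "M \<le> real B"
    using real_arch_simple by blast
  define N where "N n k x = real (card (hit x \<inter> {c \<in> range proj. real k / real (Suc n) \<le> u c}))" for n k x
  define R where "R = {x \<in> space \<mu>. finite (hit x \<inter> L)}"
  \<comment> \<open>The levels start at k = 1, since the superlevel set for k = 0 is the whole
    quotient, which need not be compact. Off R the value 0 matches the value of \<open>sum\<close>
    over an infinite set.\<close>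
  define s where "s n x = (if x \<in> R then (\<Sum>k\<in>{1..Suc n * B}. N n k x) / real (Suc n) else 0)" for n x
  have R [measurable]: "R \<in> sets (completion \<mu>)"
    unfolding R_def by (rule hits_compact(4)[OF L])
  \<comment> \<open>The number of k \<ge> 1 with k \<le> (n + 1) u(c) is the floor of (n + 1) u(c),
    so exchanging the two sums discretizes u from below.\<close>
  have N_sum: "(\<Sum>k\<in>{1..Suc n * B}. N n k x) / real (Suc n)
      = (\<Sum>c\<in>hit x \<inter> L. real_of_int \<lfloor>real (Suc n) * u c\<rfloor> / real (Suc n))"
    if x: "finite (hit x \<inter> L)" for n x
  proof -
    let ?I = "{1..Suc n * B}"
    have "N n k x = (\<Sum>c\<in>hit x \<inter> L. of_bool (real k \<le> real (Suc n) * u c))" if "k \<in> ?I" for k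
    proof -
      have "hit x \<inter> {c \<in> range proj. real k / real (Suc n) \<le> u c}
          = {c \<in> hit x \<inter> L. real k \<le> real (Suc n) * u c}"
      proof (intro equalityI subsetI)
        fix c assume c: "c \<in> hit x \<inter> {c \<in> range proj. real k / real (Suc n) \<le> u c}"
        then have "real k \<le> real (Suc n) * u c"
          by (simp add: divide_le_eq mult.commute)
        moreover from this have "u c \<noteq> 0"
          using that by auto
        ultimately show "c \<in> {c \<in> hit x \<inter> L. real k \<le> real (Suc n) * u c}"
          using c supp[of c] by auto
      next
        fix c assume "c \<in> {c \<in> hit x \<inter> L. real k \<le> real (Suc n) * u c}"
        then show "c \<in> hit x \<inter> {c \<in> range proj. real k / real (Suc n) \<le> u c}"
          using hit_subset[of x] by (auto simp: divide_le_eq mult.commute)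
      qed
      then show ?thesis
        using x by (simp add: N_def sum.If_cases of_bool_def Int_def)
    qed
    then have "(\<Sum>k\<in>?I. N n k x) = (\<Sum>k\<in>?I. \<Sum>c\<in>hit x \<inter> L. of_bool (real k \<le> real (Suc n) * u c))"
      by (rule sum.cong[OF refl])
    also have "\<dots> = (\<Sum>c\<in>hit x \<inter> L. \<Sum>k\<in>?I. of_bool (real k \<le> real (Suc n) * u c))"
      by (rule sum.swap)
    also have "\<dots> = (\<Sum>c\<in>hit x \<inter> L. real_of_int \<lfloor>real (Suc n) * u c\<rfloor>)"
    proof (rule sum.cong[OF refl])
      fix c assume c: "c \<in> hit x \<inter> L"
      then have "c \<in> range proj"
        using hit_subset[of x] by blast
      then have c': "0 \<le> u c" "u c \<le> M"
        by (rule u)+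
      have le: "real (Suc n) * u c \<le> real (Suc n * B)"
        using c'(2) B by (simp only: of_nat_mult) (intro mult_left_mono, auto)
      have nn: "0 \<le> real (Suc n) * u c"
        using c'(1) by simp
      have "{k \<in> ?I. real k \<le> real (Suc n) * u c} = {1..nat \<lfloor>real (Suc n) * u c\<rfloor>}"
      proof (intro equalityI subsetI)
        fix k assume "k \<in> {k \<in> ?I. real k \<le> real (Suc n) * u c}"
        then show "k \<in> {1..nat \<lfloor>real (Suc n) * u c\<rfloor>}"
          by (simp add: le_nat_floor)
      next
        fix k assume "k \<in> {1..nat \<lfloor>real (Suc n) * u c\<rfloor>}"
        then have k: "1 \<le> k" "real k \<le> real (Suc n) * u c"
          using nn by (auto simp: le_nat_iff le_floor_iff)
        then have "real k \<le> real (Suc n * B)"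
          using le by linarith
        with k show "k \<in> {k \<in> ?I. real k \<le> real (Suc n) * u c}"
          by (simp only: of_nat_le_iff) simp
      qed
      then have "(\<Sum>k\<in>?I. of_bool (real k \<le> real (Suc n) * u c)) = real (nat \<lfloor>real (Suc n) * u c\<rfloor>)"
        by (simp add: sum.If_cases of_bool_def Int_def)
      also have "\<dots> = real_of_int \<lfloor>real (Suc n) * u c\<rfloor>"
        using nn by simp
      finally show "(\<Sum>k\<in>?I. of_bool (real k \<le> real (Suc n) * u c)) = real_of_int \<lfloor>real (Suc n) * u c\<rfloor>" .
    qed
    finally show ?thesis
      by (simp add: sum_divide_distrib)
  qed
  have floor_lim: "(\<lambda>n. real_of_int \<lfloor>real (Suc n) * t\<rfloor> / real (Suc n)) \<longlonglongrightarrow> t" for t :: real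
  proof (rule tendsto_sandwich)
    show "(\<lambda>n. t - 1 / real (Suc n)) \<longlonglongrightarrow> t"
      using tendsto_diff[OF tendsto_const[of t] LIMSEQ_inverse_real_of_nat] by (simp add: inverse_eq_divide)
    show "(\<lambda>n. t) \<longlonglongrightarrow> t" by simp
    show "\<forall>\<^sub>F n in sequentially. t - 1 / real (Suc n) \<le> real_of_int \<lfloor>real (Suc n) * t\<rfloor> / real (Suc n)"
    proof (intro always_eventually allI)
      fix n
      have "real (Suc n) * t - 1 \<le> real_of_int \<lfloor>real (Suc n) * t\<rfloor>"
        by linarith
      then have "(real (Suc n) * t - 1) / real (Suc n) \<le> real_of_int \<lfloor>real (Suc n) * t\<rfloor> / real (Suc n)"
        by (rule divide_right_mono) simp
      then show "t - 1 / real (Suc n) \<le> real_of_int \<lfloor>real (Suc n) * t\<rfloor> / real (Suc n)"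
        by (simp add: diff_divide_distrib)
    qed
    show "\<forall>\<^sub>F n in sequentially. real_of_int \<lfloor>real (Suc n) * t\<rfloor> / real (Suc n) \<le> t"
    proof (intro always_eventually allI)
      fix n
      have "real_of_int \<lfloor>real (Suc n) * t\<rfloor> / real (Suc n) \<le> (real (Suc n) * t) / real (Suc n)"
        by (intro divide_right_mono) simp_all
      then show "real_of_int \<lfloor>real (Suc n) * t\<rfloor> / real (Suc n) \<le> t"
        by simp
    qed
  qed
  show ?thesis
  proof (rule borel_measurable_LIMSEQ_real)
    show "s n \<in> borel_measurable (completion \<mu>)" for n
    proof -
      have "(\<lambda>x. N n k x) \<in> borel_measurable (completion \<mu>)" if "k \<in> {1..Suc n * B}" for k
        unfolding N_def using that by (intro hits_compact(2) sub) simp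
      then have "(\<lambda>x. (\<Sum>k\<in>{1..Suc n * B}. N n k x) / real (Suc n)) \<in> borel_measurable (completion \<mu>)"
        by (intro borel_measurable_divide borel_measurable_sum) auto
      then show ?thesis
        unfolding s_def by (intro measurable_If_set) auto
    qed
    fix x assume x: "x \<in> space (completion \<mu>)"
    show "(\<lambda>n. s n x) \<longlonglongrightarrow> (\<Sum>c\<in>hit x \<inter> L. u c)"
    proof (cases "finite (hit x \<inter> L)")
      case True
      then have "s n x = (\<Sum>c\<in>hit x \<inter> L. real_of_int \<lfloor>real (Suc n) * u c\<rfloor> / real (Suc n))" for n
        unfolding s_def N_sum[OF True] using x by (simp add: R_def)
      moreover have "(\<lambda>n. \<Sum>c\<in>hit x \<inter> L. real_of_int \<lfloor>real (Suc n) * u c\<rfloor> / real (Suc n)) \<longlonglongrightarrow> (\<Sum>c\<in>hit x \<inter> L. u c)"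
        by (intro tendsto_sum floor_lim)
      ultimately show ?thesis
        by simp
    next
      case False
      then show ?thesis
        by (simp add: s_def R_def)
    qed
  qed
qed

text \<open>For t > 0 the superlevel set is closed and, because r vanishes at 0, contained in the
  compact support. The function r is left free so that it can be a positive or negative part of the
  real or imaginary part.\<close>

lemma Cc_bounded_support:
  assumes f: "f \<in> Cc T"
  obtains L M where "compactin T L" "\<And>c. c \<in> range proj \<Longrightarrow> f c \<noteq> 0 \<Longrightarrow> c \<in> L"
    "0 \<le> M" "\<And>c. c \<in> range proj \<Longrightarrow> norm (f c) \<le> M"
    "\<And>(r :: complex \<Rightarrow> real) t. continuous_on UNIV r \<Longrightarrow> r 0 = 0 \<Longrightarrow> t > 0 \<Longrightarrow>
      compactin T {c \<in> range proj. t \<le> r (f c)}"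
proof -
  define L where "L = T closure_of {c \<in> topspace T. f c \<noteq> 0}"
  have cont: "continuous_map T euclidean f" and L: "compactin T L"
    using f by (auto simp: Cc_def L_def)
  have supp: "c \<in> L" if "c \<in> range proj" "f c \<noteq> 0" for c
    using that closure_of_subset[of "{c \<in> topspace T. f c \<noteq> 0}" T] unfolding L_def by auto
  have "compact (f ` L)"
    using image_compactin[OF L cont] by simp
  then obtain M where M: "\<And>c. c \<in> L \<Longrightarrow> norm (f c) \<le> M"
    using compact_imp_bounded by (force simp: bounded_iff)
  have "norm (f c) \<le> max M 0" if "c \<in> range proj" for c
    using M[of c] supp[OF that] by (cases "f c = 0") auto
  moreover have "compactin T {c \<in> range proj. t \<le> r (f c)}"
    if r: "continuous_on UNIV r" "r 0 = 0" "t > 0" for r :: "complex \<Rightarrow> real" and t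
  proof (rule closed_compactin[OF L])
    show "{c \<in> range proj. t \<le> r (f c)} \<subseteq> L"
      using supp r by force
    have "closed {z. t \<le> r z}"
      using closed_vimage[of "{t..}" r] r(1) by (simp add: vimage_def)
    then have "closedin T {c \<in> topspace T. f c \<in> {z. t \<le> r z}}"
      using cont by (intro closedin_continuous_map_preimage[OF cont]) simp
    then show "closedin T {c \<in> range proj. t \<le> r (f c)}"
      by simp
  qed
  ultimately show ?thesis
    using that[OF L supp, of "max M 0"] by simp
qed

lemma infsum_hits:
  fixes f :: "'g set \<Rightarrow> complex"
  assumes "finite (hit x \<inter> L)" "\<And>c. c \<in> range proj \<Longrightarrow> f c \<noteq> 0 \<Longrightarrow> c \<in> L"
  shows "f summable_on hit x" "transverse_sum G H act Y f x = (\<Sum>c\<in>hit x \<inter> L. f c)"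
proof -
  have z: "f c = 0" if "c \<in> hit x - L" for c
    using that assms(2) hit_subset by blast
  have "f summable_on hit x \<inter> L"
    using assms(1) by (rule summable_on_finite)
  then show "f summable_on hit x"
    by (rule summable_on_cong_neutral[THEN iffD1, rotated -1]) (use z in auto)
  have "transverse_sum G H act Y f x = infsum f (hit x \<inter> L)"
    unfolding transverse_sum_def by (rule infsum_cong_neutral) (use z in auto)
  then show "transverse_sum G H act Y f x = (\<Sum>c\<in>hit x \<inter> L. f c)"
    using assms(1) by simp
qed

text \<open>Off a null set only finitely many hitting times lie in the support, and the sum is
  bounded by M times their number, which is integrable. Measurability comes from splitting f into
  four nonnegative parts.\<close>

lemma transverse_sum_Cc:
  assumes f: "f \<in> Cc T"
  shows "AE x in \<mu>. f summable_on hit x"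
    and "integrable (completion \<mu>) (transverse_sum G H act Y f)"
proof -
  obtain L M where L: "compactin T L" and supp: "\<And>c. c \<in> range proj \<Longrightarrow> f c \<noteq> 0 \<Longrightarrow> c \<in> L"
    and M: "0 \<le> M" "\<And>c. c \<in> range proj \<Longrightarrow> norm (f c) \<le> M"
    and sub: "\<And>(r :: complex \<Rightarrow> real) t. continuous_on UNIV r \<Longrightarrow> r 0 = 0 \<Longrightarrow> t > 0 \<Longrightarrow>
      compactin T {c \<in> range proj. t \<le> r (f c)}"
    using Cc_bounded_support[OF f] by blast
  show "AE x in \<mu>. f summable_on hit x"
    using hits_compact(1)[OF L] by eventually_elim (rule infsum_hits(1)[OF _ supp])
  have m: "(\<lambda>x. \<Sum>c\<in>hit x \<inter> L. r (f c)) \<in> borel_measurable (completion \<mu>)"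
    if r: "continuous_on UNIV r" "r 0 = 0" "\<And>z. 0 \<le> r z" "\<And>z. r z \<le> norm z" for r :: "complex \<Rightarrow> real"
  proof (rule sum_hits_measurable[OF L sub[OF r(1,2)]])
    show "c \<in> L" if "c \<in> range proj" "r (f c) \<noteq> 0" for c
      using that r(2) supp by metis
    show "r (f c) \<le> M" if "c \<in> range proj" for c
      using r(4) M(2)[OF that] order_trans by blast
  qed (use r in auto)
  have decomp: "z = complex_of_real (max 0 (Re z)) - complex_of_real (max 0 (- Re z))
      + \<i> * (complex_of_real (max 0 (Im z)) - complex_of_real (max 0 (- Im z)))" for z
    by (simp add: complex_eq_iff max_def)
  have bd: "\<bar>Re z\<bar> \<le> norm z" "\<bar>Im z\<bar> \<le> norm z" for z
    by (rule abs_Re_le_cmod abs_Im_le_cmod)+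
  have "(\<lambda>x. \<Sum>c\<in>hit x \<inter> L. f c) = (\<lambda>x. complex_of_real (\<Sum>c\<in>hit x \<inter> L. max 0 (Re (f c)))
      - complex_of_real (\<Sum>c\<in>hit x \<inter> L. max 0 (- Re (f c)))
      + \<i> * (complex_of_real (\<Sum>c\<in>hit x \<inter> L. max 0 (Im (f c)))
      - complex_of_real (\<Sum>c\<in>hit x \<inter> L. max 0 (- Im (f c)))))"
    by (subst decomp) (simp only: sum.distrib sum_subtractf sum_distrib_left[symmetric] of_real_sum)
  also have "\<dots> \<in> borel_measurable (completion \<mu>)"
  proof -
    have "(\<lambda>x. \<Sum>c\<in>hit x \<inter> L. max 0 (Re (f c))) \<in> borel_measurable (completion \<mu>)"
      "(\<lambda>x. \<Sum>c\<in>hit x \<inter> L. max 0 (- Re (f c))) \<in> borel_measurable (completion \<mu>)"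
      "(\<lambda>x. \<Sum>c\<in>hit x \<inter> L. max 0 (Im (f c))) \<in> borel_measurable (completion \<mu>)"
      "(\<lambda>x. \<Sum>c\<in>hit x \<inter> L. max 0 (- Im (f c))) \<in> borel_measurable (completion \<mu>)"
      using bd by (intro m[of "\<lambda>z. max 0 (Re z)"] m[of "\<lambda>z. max 0 (- Re z)"] m[of "\<lambda>z. max 0 (Im z)"]
        m[of "\<lambda>z. max 0 (- Im z)"]; auto intro!: continuous_intros simp: abs_le_iff)+
    then show ?thesis
      by (intro borel_measurable_add borel_measurable_diff borel_measurable_times borel_measurable_const
        measurable_compose[OF _ borel_measurable_of_real])
  qed
  finally have meas: "(\<lambda>x. \<Sum>c\<in>hit x \<inter> L. f c) \<in> borel_measurable (completion \<mu>)" .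
  \<comment> \<open>If infinitely many hitting times lie in L, \<open>sum\<close> returns 0 while
    the infinite sum may differ; such x form a null set.\<close>
  have ae: "AE x in \<mu>. (\<Sum>c\<in>hit x \<inter> L. f c) = transverse_sum G H act Y f x"
    using hits_compact(1)[OF L] by eventually_elim (rule infsum_hits(2)[OF _ supp, symmetric])
  have "integrable (completion \<mu>) (\<lambda>x. \<Sum>c\<in>hit x \<inter> L. f c)"
  proof (rule Bochner_Integration.integrable_bound)
    show "integrable (completion \<mu>) (\<lambda>x. M * real (card (hit x \<inter> L)))"
      by (intro integrable_mult_right hits_compact(3)[OF L])
    show "AE x in completion \<mu>. norm (\<Sum>c\<in>hit x \<inter> L. f c) \<le> norm (M * real (card (hit x \<inter> L)))"
    proof (rule AE_I2)
      fix x
      have "norm (\<Sum>c\<in>hit x \<inter> L. f c) \<le> real (card (hit x \<inter> L)) * M"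
        using M(2) hit_subset by (intro sum_norm_le[THEN order_trans[OF _ sum_bounded_above]]) blast+
      then show "norm (\<Sum>c\<in>hit x \<inter> L. f c) \<le> norm (M * real (card (hit x \<inter> L)))"
        using M(1) by (simp add: mult.commute)
    qed
  qed (rule meas)
  then show "integrable (completion \<mu>) (transverse_sum G H act Y f)"
    using AE_completion[OF ae] measurable_completion_AE[OF meas ae]
    by (subst integrable_cong_AE[of _ _ "\<lambda>x. \<Sum>c\<in>hit x \<inter> L. f c"]) (auto simp: meas)
qed

section \<open>Translated integrals over the cross section\<close>

text \<open>The dual lifted to the group and taken against \<sigma> instead of its completion. For
  Borel \<phi> both integrals agree, and measurability in g follows from joint measurability of the
  action.\<close>

definition dual :: "('x \<Rightarrow> complex) \<Rightarrow> 'g \<Rightarrow> complex" where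
  "dual \<phi> g = (LINT y|\<sigma>. \<phi> (act (inv g) y))"

lemma act_inv_H_mult:
  assumes "y \<in> Y"
  shows "act (inv (a \<otimes> g)) y = act (inv g) (act (inv a) y)"
  using assms act_mult[OF Y_space, of y "inv g" "inv a"] by (simp add: inv_mult_group)

lemma dual_measurable:
  assumes [measurable]: "\<phi> \<in> borel_measurable X"
  shows "dual \<phi> \<in> borel_measurable borel"
  unfolding dual_def[abs_def] by measurable

lemma dual_bounded:
  assumes [measurable]: "\<phi> \<in> borel_measurable X" and C: "\<And>x. norm (\<phi> x) \<le> C"
  shows "integrable \<sigma> (\<lambda>y. \<phi> (act (inv g) y))" "norm (dual \<phi> g) \<le> C * measure \<sigma> Y"
proof -
  show int: "integrable \<sigma> (\<lambda>y. \<phi> (act (inv g) y))"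
    using C by (intro \<sigma>.integrable_const_bound[where B = C]) auto
  have "norm (dual \<phi> g) \<le> (LINT y|\<sigma>. norm (\<phi> (act (inv g) y)))"
    unfolding dual_def by (rule integral_norm_bound)
  also have "\<dots> \<le> (LINT y|\<sigma>. C)"
    using int C by (intro integral_mono integrable_norm) auto
  also have "\<dots> = C * measure \<sigma> Y"
    by simp
  finally show "norm (dual \<phi> g) \<le> C * measure \<sigma> Y" .
qed

text \<open>(a g)^-1 y = g^-1 (a^-1 y), and \<sigma> is invariant under a^-1.\<close>

lemma dual_mult:
  assumes [measurable]: "\<phi> \<in> borel_measurable X" and a: "a \<in> H"
  shows "dual \<phi> (a \<otimes> g) = dual \<phi> g"
proof -
  have "dual \<phi> g = (LINT y|distr \<sigma> \<sigma> (act (inv a)). \<phi> (act (inv g) y))"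
    using a by (simp add: dual_def distr_\<sigma>)
  also have "\<dots> = (LINT y|\<sigma>. \<phi> (act (inv g) (act (inv a) y)))"
    using a by (intro integral_distr measurable_act_\<sigma>) auto
  also have "\<dots> = dual \<phi> (a \<otimes> g)"
    unfolding dual_def by (intro Bochner_Integration.integral_cong) (auto simp: act_inv_H_mult)
  finally show ?thesis by simp
qed

text \<open>The function u is arbitrary. Using invariance under a^-1 as well shows that either both
  functions are integrable or neither is, and in the latter case both integrals have the default
  value 0. Hence the formula for the dual holds at every coset, not just at almost every
  one.\<close>

lemma completion_\<sigma>_act:
  fixes u :: "'x \<Rightarrow> complex"
  assumes a: "a \<in> H"
  shows "integrable (completion \<sigma>) (\<lambda>y. u (act a y)) \<longleftrightarrow> integrable (completion \<sigma>) u"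
    and "(LINT y|completion \<sigma>. u (act a y)) = (LINT y|completion \<sigma>. u y)"
proof -
  have meas: "act b \<in> completion \<sigma> \<rightarrow>\<^sub>M completion \<sigma>"
    and dist: "distr (completion \<sigma>) (completion \<sigma>) (act b) = completion \<sigma>" if b: "b \<in> H" for b
  proof -
    have d: "distr (completion \<sigma>) \<sigma> (act b) = \<sigma>"
      using distr_completion[OF measurable_act_\<sigma>[OF b]] distr_\<sigma>[OF b] by simp
    have m: "act b \<in> completion \<sigma> \<rightarrow>\<^sub>M \<sigma>"
      by (intro measurable_completion measurable_act_\<sigma> b)
    show "act b \<in> completion \<sigma> \<rightarrow>\<^sub>M completion \<sigma>"
      using completion.measurable_completion2[OF m] d by simp
    show "distr (completion \<sigma>) (completion \<sigma>) (act b) = completion \<sigma>"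
      using completion.completion_distr_eq[OF m] d by simp
  qed
  have push: "integrable (completion \<sigma>) (\<lambda>y. v (act b y))"
    if "b \<in> H" "integrable (completion \<sigma>) v" for b and v :: "'x \<Rightarrow> complex"
    using integrable_distr[OF meas[OF that(1)], of v] that dist by simp
  show iff: "integrable (completion \<sigma>) (\<lambda>y. u (act a y)) \<longleftrightarrow> integrable (completion \<sigma>) u"
  proof
    assume "integrable (completion \<sigma>) (\<lambda>y. u (act a y))"
    then have "integrable (completion \<sigma>) (\<lambda>y. u (act a (act (inv a) y)))"
      using push[of "inv a" "\<lambda>y. u (act a y)"] a by simp
    then show "integrable (completion \<sigma>) u"
      by (rule Bochner_Integration.integrable_cong[THEN iffD1, rotated -1]) (auto simp: Y_space)
  qed (rule push[OF a])
  show "(LINT y|completion \<sigma>. u (act a y)) = (LINT y|completion \<sigma>. u y)"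
  proof (cases "integrable (completion \<sigma>) u")
    case True
    then have "(LINT y|distr (completion \<sigma>) (completion \<sigma>) (act a). u y) = (LINT y|completion \<sigma>. u (act a y))"
      by (intro integral_distr meas a) auto
    then show ?thesis
      using dist[OF a] by simp
  next
    case False
    with iff show ?thesis
      by (simp add: not_integrable_integral_eq)
  qed
qed

lemma integral_completion_\<sigma>_mult:
  assumes a: "a \<in> H"
  shows "(LINT y|completion \<sigma>. \<phi> (act (inv (a \<otimes> g)) y) :: complex) = (LINT y|completion \<sigma>. \<phi> (act (inv g) y))"
proof -
  have "(LINT y|completion \<sigma>. \<phi> (act (inv (a \<otimes> g)) y)) = (LINT y|completion \<sigma>. \<phi> (act (inv g) (act (inv a) y)))"
    by (intro Bochner_Integration.integral_cong) (auto simp: act_inv_H_mult)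
  also have "\<dots> = (LINT y|completion \<sigma>. \<phi> (act (inv g) y))"
    using completion_\<sigma>_act(2)[of "inv a" "\<lambda>y. \<phi> (act (inv g) y)"] a by simp
  finally show ?thesis .
qed

lemma transverse_dual_proj:
  "transverse_dual G act \<sigma> \<phi> (proj g) = (LINT y|completion \<sigma>. \<phi> (act (inv g) y))"
  unfolding transverse_dual_def by (rule at_coset_proj) (rule integral_completion_\<sigma>_mult)

section \<open>The defining identity for product functions\<close>

lemma transverse_identity:
  fixes \<psi> :: "'g \<Rightarrow> complex"
  assumes \<psi>[measurable]: "\<psi> \<in> borel_measurable borel" and B: "\<And>g. norm (\<psi> g) \<le> B"
    and K: "compact K" "\<And>g. g \<notin> K \<Longrightarrow> \<psi> g = 0"
    and \<phi>[measurable]: "\<phi> \<in> borel_measurable X" and C: "\<And>x. norm (\<phi> x) \<le> C"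
  shows "(LINT x|completion \<mu>. transverse_sum G H act Y (at_coset (\<lambda>g. LINT h|mH. \<psi> (h \<otimes> g))) x * \<phi> x)
    = (LINT g|mG. \<psi> g * dual \<phi> g)"
proof -
  define F where "F = (\<lambda>(g, y). \<psi> (inv g) * \<phi> (act g y))"
  have F: "F \<in> borel_measurable (borel \<Otimes>\<^sub>M restrict_space X Y)"
  proof -
    have [measurable]: "(\<lambda>p. snd p) \<in> borel \<Otimes>\<^sub>M restrict_space X Y \<rightarrow>\<^sub>M X" for borel :: "'g measure"
      by (rule measurable_compose[OF measurable_snd]) (rule measurable_restrict_space1, measurable)
    show ?thesis
      unfolding F_def split_beta' by measurable
  qed
  have F_bound: "norm (F (g, y)) \<le> B * C" for g y
    unfolding F_def using B[of "inv g"] C[of "act g y"]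
    by (simp add: norm_mult) (meson mult_mono norm_ge_zero order_trans)
  \<comment> \<open>The group variable enters F through the inverse, so the compact set is
    K^-1.\<close>
  have F_supp: "F (g, y) = 0" if "g \<notin> (\<lambda>x. inv x) ` K" for g y
  proof -
    have "inv g \<notin> K"
      using that by (metis image_eqI in_carrier inv_inv)
    then show ?thesis
      by (simp add: F_def K(2))
  qed
  have "(LINT x|completion \<mu>. (\<Sum>\<^sub>\<infinity>c\<in>hit x.
        at_coset (\<lambda>g. LINT h|mH. F (inv (h \<otimes> g), act (h \<otimes> g) x)) c)) = (LINT g|mG. LINT y|\<sigma>. F (g, y))"
  proof (rule \<sigma>[unfolded transverse_measure_def, THEN conjunct2, THEN conjunct2, THEN conjunct2,
        THEN spec, THEN mp], intro conjI)
    show "F \<in> borel_measurable (borel \<Otimes>\<^sub>M restrict_space X Y)" by fact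
    show "\<exists>C. \<forall>g\<in>carrier G. \<forall>y\<in>Y. norm (F (g, y)) \<le> C"
      using F_bound by blast
    show "\<exists>L. compact L \<and> L \<subseteq> carrier G \<and> (\<forall>g\<in>carrier G - L. \<forall>y\<in>Y. F (g, y) = 0)"
      using F_supp compact_inv_image[OF K(1)] by (intro exI[of _ "(\<lambda>x. inv x) ` K"]) auto
  qed
  also have "(LINT g|mG. LINT y|\<sigma>. F (g, y)) = (LINT g|mG. \<psi> (inv g) * dual \<phi> (inv g))"
    by (simp add: F_def dual_def)
  also have "\<dots> = (LINT g|distr mG mG (\<lambda>x. inv x). \<psi> g * dual \<phi> g)"
    using dual_measurable[OF \<phi>] by (intro integral_distr[symmetric]) measurable
  also have "\<dots> = (LINT g|mG. \<psi> g * dual \<phi> g)"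
    by (simp add: distr_inv)
  finally have "(LINT x|completion \<mu>. (\<Sum>\<^sub>\<infinity>c\<in>hit x.
        at_coset (\<lambda>g. LINT h|mH. F (inv (h \<otimes> g), act (h \<otimes> g) x)) c)) = (LINT g|mG. \<psi> g * dual \<phi> g)" .
  moreover have "(\<Sum>\<^sub>\<infinity>c\<in>hit x. at_coset (\<lambda>g. LINT h|mH. F (inv (h \<otimes> g), act (h \<otimes> g) x)) c)
      = transverse_sum G H act Y (at_coset (\<lambda>g. LINT h|mH. \<psi> (h \<otimes> g))) x * \<phi> x"
    if x: "x \<in> space (completion \<mu>)" for x
  proof -
    have "at_coset (\<lambda>g. LINT h|mH. F (inv (h \<otimes> g), act (h \<otimes> g) x)) c
        = at_coset (\<lambda>g. LINT h|mH. \<psi> (h \<otimes> g)) c * \<phi> x" for c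
      using x by (simp add: F_def at_coset_def)
    \<comment> \<open>A constant from a field is 0 or preserves summability in both directions, so
      the factor comes out of the infinite sum for every x.\<close>
    then show ?thesis
      by (simp add: transverse_sum_def infsum_cmult_left')
  qed
  then have "(LINT x|completion \<mu>. (\<Sum>\<^sub>\<infinity>c\<in>hit x.
        at_coset (\<lambda>g. LINT h|mH. F (inv (h \<otimes> g), act (h \<otimes> g) x)) c))
      = (LINT x|completion \<mu>. transverse_sum G H act Y (at_coset (\<lambda>g. LINT h|mH. \<psi> (h \<otimes> g))) x * \<phi> x)"
    by (intro Bochner_Integration.integral_cong refl)
  ultimately show ?thesis
    by simp
qed

text \<open>Take for \<psi> the indicator of the closure of W n. The left side of the identity
  vanishes because its factor \<open>indicator N\<close> is 0 almost everywhere, whatever the sum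
  is. On the right stands the integral of the nonnegative function d over a compact set, so d is 0
  almost everywhere there; these sets exhaust G.\<close>

lemma null_set_translates:
  assumes N: "N \<in> null_sets \<mu>"
  shows "AE c in mQ. \<forall>g\<in>c. AE y in \<sigma>. act (inv g) y \<notin> N"
proof -
  have [measurable]: "N \<in> sets X"
    using N by auto
  obtain W :: "nat \<Rightarrow> 'g set" where W: "\<And>n. open (W n)" "\<And>n. compact (closure (W n))"
      "incseq W" "(\<Union>n. W n) = UNIV"
    using exhaustion by blast
  define \<phi> :: "'x \<Rightarrow> complex" where "\<phi> = indicator N"
  have \<phi>[measurable]: "\<phi> \<in> borel_measurable X"
    unfolding \<phi>_def by measurable
  have \<phi>_le: "norm (\<phi> x) \<le> 1" for x
    by (simp add: \<phi>_def indicator_def)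
  \<comment> \<open>The \<sigma>-measure of the set of y in Y with g^-1 y in N.\<close>
  define d where "d g = (LINT y|\<sigma>. indicator N (act (inv g) y) :: real)" for g
  have dual_d: "dual \<phi> g = complex_of_real (d g)" for g
    unfolding dual_def d_def \<phi>_def by (subst integral_complex_of_real[symmetric])
      (intro Bochner_Integration.integral_cong, auto simp: indicator_def)
  have d_nonneg: "0 \<le> d g" for g
    unfolding d_def by (intro Bochner_Integration.integral_nonneg) simp
  have d_meas [measurable]: "d \<in> borel_measurable borel"
  proof -
    have "d = (\<lambda>g. Re (dual \<phi> g))"
      by (simp add: dual_d)
    then show ?thesis
      using dual_measurable[OF \<phi>] by simp
  qed
  have "AE g in mG. g \<in> closure (W n) \<longrightarrow> d g = 0" for n
  proof -
    let ?K = "closure (W n)"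
    have [measurable]: "?K \<in> sets borel"
      by simp
    define \<psi> :: "'g \<Rightarrow> complex" where "\<psi> = indicator ?K"
    have "(LINT x|completion \<mu>. transverse_sum G H act Y (at_coset (\<lambda>g. LINT h|mH. \<psi> (h \<otimes> g))) x * \<phi> x)
        = (LINT g|mG. \<psi> g * dual \<phi> g)"
      by (rule transverse_identity[where B = 1 and K = ?K and C = 1])
        (auto simp: \<psi>_def \<phi>_le W(2) indicator_def of_bool_def)
    moreover have "(LINT x|completion \<mu>. transverse_sum G H act Y (at_coset (\<lambda>g. LINT h|mH. \<psi> (h \<otimes> g))) x * \<phi> x) = 0"
    proof (rule integral_eq_zero_AE)
      have "AE x in completion \<mu>. x \<notin> N"
        using AE_completion[OF AE_not_in[OF N]] .
      then show "AE x in completion \<mu>. transverse_sum G H act Y (at_coset (\<lambda>g. LINT h|mH. \<psi> (h \<otimes> g))) x * \<phi> x = 0"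
        by eventually_elim (simp add: \<phi>_def)
    qed
    moreover have "\<psi> g * dual \<phi> g = complex_of_real (indicator ?K g * d g)" for g
      by (simp add: \<psi>_def dual_d indicator_def)
    ultimately have "complex_of_real (LINT g|mG. indicator ?K g * d g) = 0"
      unfolding integral_complex_of_real[symmetric] by simp
    then have z: "(LINT g|mG. indicator ?K g * d g) = 0"
      by (simp only: of_real_eq_0_iff)
    \<comment> \<open>Necessary because a Bochner integral is also 0 for nonintegrable functions.
      The bound is d \<le> \<sigma>(Y) on a set of finite Haar measure.\<close>
    have "integrable mG (\<lambda>g. indicator ?K g * d g)"
    proof (rule Bochner_Integration.integrable_bound)
      show "integrable mG (\<lambda>g. measure \<sigma> Y * indicator ?K g :: real)"
        using haar_finite_on_compact[OF W(2), of n]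
        by (intro integrable_mult_right integrable_real_indicator) auto
      show "AE g in mG. norm (indicator ?K g * d g) \<le> norm (measure \<sigma> Y * indicator ?K g :: real)"
      proof (rule AE_I2)
        fix g
        have "norm (dual \<phi> g) \<le> 1 * measure \<sigma> Y"
          by (rule dual_bounded(2)[OF \<phi> \<phi>_le])
        then show "norm (indicator ?K g * d g) \<le> norm (measure \<sigma> Y * indicator ?K g :: real)"
          by (auto simp: dual_d indicator_def)
      qed
    qed measurable
    then have "AE g in mG. indicator ?K g * d g = 0"
      using z d_nonneg by (subst integral_nonneg_eq_0_iff_AE[symmetric]) auto
    then show ?thesis
      by eventually_elim (auto simp: indicator_def)
  qed
  then have "AE g in mG. \<forall>n. g \<in> closure (W n) \<longrightarrow> d g = 0"
    unfolding AE_all_countable by blast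
  then have "AE g in mG. d g = 0"
  proof (rule AE_mp, intro AE_I2 impI)
    fix g assume "\<forall>n. g \<in> closure (W n) \<longrightarrow> d g = 0"
    then show "d g = 0"
      using W(4) closure_subset by blast
  qed
  moreover have "{g. d g = 0} \<in> sets borel"
    using measurable_sets[OF d_meas, of "{0}"] by (simp add: vimage_def)
  moreover have "d (a \<otimes> g) = d g" if "a \<in> H" for a g
    using dual_mult[OF \<phi> that, of g] by (simp add: dual_d)
  ultimately have "AE c in mQ. \<forall>g\<in>c. d g = 0"
    by (intro invariant_AE_descends) auto
  then show ?thesis
  proof (rule eventually_mono, intro ballI)
    fix c g assume "\<forall>g\<in>c. d g = 0" "g \<in> c"
    then have "d g = 0" by blast
    moreover have "integrable \<sigma> (\<lambda>y. indicator N (act (inv g) y) :: real)"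
      by (intro \<sigma>.integrable_const_bound[where B = 1]) auto
    ultimately have "AE y in \<sigma>. (indicator N (act (inv g) y) :: real) = 0"
      unfolding d_def by (subst integral_nonneg_eq_0_iff_AE[symmetric]) auto
    then show "AE y in \<sigma>. act (inv g) y \<notin> N"
      by eventually_elim (auto simp: indicator_def)
  qed
qed

section \<open>Bounded functions modulo null sets\<close>

lemma null_property_translates:
  assumes "AE x in \<mu>. P x"
  shows "AE c in mQ. \<forall>g\<in>c. AE y in \<sigma>. P (act (inv g) y)"
proof -
  obtain N where N: "{x \<in> space \<mu>. \<not> P x} \<subseteq> N" "N \<in> null_sets \<mu>"
    using assms by (metis AE_E null_setsI)
  show ?thesis
    using null_set_translates[OF N(2)]
  proof (rule eventually_mono, intro ballI)
    fix c g assume "\<forall>g\<in>c. AE y in \<sigma>. act (inv g) y \<notin> N" "g \<in> c"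
    then have "AE y in \<sigma>. act (inv g) y \<notin> N" by blast
    then show "AE y in \<sigma>. P (act (inv g) y)"
      by (rule AE_mp) (intro AE_I2, use N(1) Y_space in auto)
  qed
qed

text \<open>A Borel representative is set to 0 where it exceeds the essential bound. This changes it
  only on a null set and makes it bounded at every point, as the identity defining \<sigma>
  demands.\<close>

lemma Linf_representative:
  assumes "\<phi> \<in> Linf_space \<mu>"
  obtains \<phi>' C where "\<phi>' \<in> borel_measurable X" "\<And>x. norm (\<phi>' x) \<le> C" "AE x in \<mu>. \<phi> x = \<phi>' x"
proof -
  obtain C where C: "AE x in \<mu>. norm (\<phi> x) \<le> C"
    using assms by (auto simp: Linf_space_def)
  obtain \<theta> where \<theta>: "\<theta> \<in> borel_measurable \<mu>" "AE x in \<mu>. \<phi> x = \<theta> x"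
  proof -
    have "\<phi> \<in> borel_measurable (completion \<mu>)"
      using assms by (simp add: Linf_space_def)
    then show ?thesis
      using that by (rule completion_ex_borel_measurable_complex)
  qed
  have [measurable]: "\<theta> \<in> borel_measurable X"
    using \<theta>(1) by (simp cong: measurable_cong_sets)
  show ?thesis
  proof
    show "(\<lambda>x. if norm (\<theta> x) \<le> C then \<theta> x else 0) \<in> borel_measurable X"
      by measurable
    \<comment> \<open>For negative C the truncated function is 0, whose norm exceeds C; hence the
      maximum.\<close>
    show "norm (if norm (\<theta> x) \<le> C then \<theta> x else 0) \<le> max C 0" for x
      by auto
    show "AE x in \<mu>. \<phi> x = (if norm (\<theta> x) \<le> C then \<theta> x else 0)"
      using C \<theta>(2) by eventually_elim auto
  qed
qed

text \<open>Translates of the null set where the two functions differ are \<sigma>-null for almost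
  every coset, so there the translates of \<phi> inherit measurability and integrals from those of
  the Borel representative. On the remaining cosets a translate of \<phi> may fail to be
  measurable.\<close>

lemma Linf_dual:
  assumes \<phi>': "\<phi>' \<in> borel_measurable X" "\<And>x. norm (\<phi>' x) \<le> C" and ae: "AE x in \<mu>. \<phi> x = \<phi>' x"
  shows "AE c in mQ. \<forall>g\<in>c. integrable (completion \<sigma>) (\<lambda>y. \<phi> (act (inv g) y))"
    and "AE c in mQ. transverse_dual G act \<sigma> \<phi> c = at_coset (dual \<phi>') c"
proof -
  have [measurable]: "\<phi>' \<in> borel_measurable X" by fact
  have main: "AE c in mQ. \<forall>g\<in>c. integrable (completion \<sigma>) (\<lambda>y. \<phi> (act (inv g) y)) \<and>
      (LINT y|completion \<sigma>. \<phi> (act (inv g) y)) = dual \<phi>' g"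
    using null_property_translates[OF ae]
  proof (rule eventually_mono, intro ballI)
    fix c g assume "\<forall>g\<in>c. AE y in \<sigma>. \<phi> (act (inv g) y) = \<phi>' (act (inv g) y)" "g \<in> c"
    then have eq: "AE y in \<sigma>. \<phi>' (act (inv g) y) = \<phi> (act (inv g) y)" by auto
    have m': "(\<lambda>y. \<phi>' (act (inv g) y)) \<in> borel_measurable \<sigma>"
      by measurable
    have mc: "(\<lambda>y. \<phi>' (act (inv g) y)) \<in> borel_measurable (completion \<sigma>)"
      by (rule measurable_completion[OF m'])
    have m: "(\<lambda>y. \<phi> (act (inv g) y)) \<in> borel_measurable (completion \<sigma>)"
      by (rule measurable_completion_AE[OF mc eq]) simp
    have "integrable (completion \<sigma>) (\<lambda>y. \<phi>' (act (inv g) y))"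
      using dual_bounded(1)[OF \<phi>'] integrable_completion[OF m'] by simp
    then have "integrable (completion \<sigma>) (\<lambda>y. \<phi> (act (inv g) y))"
      using integrable_cong_AE[OF mc m AE_completion[OF eq]] by simp
    moreover have "(LINT y|completion \<sigma>. \<phi> (act (inv g) y)) = dual \<phi>' g"
      using integral_cong_AE[OF mc m AE_completion[OF eq]] integral_completion[OF m'] by (simp add: dual_def)
    ultimately show "integrable (completion \<sigma>) (\<lambda>y. \<phi> (act (inv g) y)) \<and>
        (LINT y|completion \<sigma>. \<phi> (act (inv g) y)) = dual \<phi>' g"
      by simp
  qed
  show "AE c in mQ. \<forall>g\<in>c. integrable (completion \<sigma>) (\<lambda>y. \<phi> (act (inv g) y))"
    using main by eventually_elim auto
  show "AE c in mQ. transverse_dual G act \<sigma> \<phi> c = at_coset (dual \<phi>') c"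
    using main
  proof (rule AE_mp, intro AE_I2 impI)
    fix c assume *: "\<forall>g\<in>c. integrable (completion \<sigma>) (\<lambda>y. \<phi> (act (inv g) y)) \<and>
      (LINT y|completion \<sigma>. \<phi> (act (inv g) y)) = dual \<phi>' g" and "c \<in> space mQ"
    then obtain g where c: "c = proj g" by auto
    then have "g \<in> c"
      by (simp add: mem_proj_iff)
    with * show "transverse_dual G act \<sigma> \<phi> c = at_coset (dual \<phi>') c"
      unfolding c transverse_dual_proj by (subst at_coset_proj) (auto simp: dual_mult)
  qed
qed

lemma at_coset_dual:
  assumes "\<phi> \<in> borel_measurable X"
  shows "at_coset (dual \<phi>) (proj g) = dual \<phi> g"
  by (rule at_coset_proj) (rule dual_mult[OF assms])

lemma at_coset_dual_measurable:
  assumes "\<phi> \<in> borel_measurable X"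
  shows "at_coset (dual \<phi>) \<in> borel_measurable mQ"
  by (rule invariant_function_descends[OF dual_measurable[OF assms] dual_mult[OF assms]])

lemma Cc_measurable:
  assumes "f \<in> Cc T"
  shows "f \<in> borel_measurable mQ"
proof (rule borel_measurableI)
  fix S :: "complex set" assume "open S"
  then have "openin T {c \<in> topspace T. f c \<in> S}"
    using assms by (intro openin_continuous_map_preimage[of T euclidean f]) (auto simp: Cc_def)
  moreover have "{c \<in> topspace T. f c \<in> S} = f -` S \<inter> space mQ"
    by auto
  ultimately show "f -` S \<inter> space mQ \<in> sets mQ"
    using openin_sets_mQ by simp
qed

section \<open>Formal adjointness\<close>

lemma adjoint_bounded:
  assumes f: "f \<in> Cc T" and \<phi>[measurable]: "\<phi> \<in> borel_measurable X" and C: "\<And>x. norm (\<phi> x) \<le> C"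
  shows "(LINT x|completion \<mu>. transverse_sum G H act Y f x * \<phi> x) = (LINT c|mQ. f c * at_coset (dual \<phi>) c)"
proof -
  obtain L M where L: "compactin T L" and supp: "\<And>c. c \<in> range proj \<Longrightarrow> f c \<noteq> 0 \<Longrightarrow> c \<in> L"
    and M: "0 \<le> M" "\<And>c. c \<in> range proj \<Longrightarrow> norm (f c) \<le> M"
    and sub: "\<And>(r :: complex \<Rightarrow> real) t. continuous_on UNIV r \<Longrightarrow> r 0 = 0 \<Longrightarrow> t > 0 \<Longrightarrow>
      compactin T {c \<in> range proj. t \<le> r (f c)}"
    using Cc_bounded_support[OF f] by blast
  obtain k :: "'g \<Rightarrow> real" and K B where k[measurable]: "k \<in> borel_measurable borel"
    and k_nonneg: "\<And>g. 0 \<le> k g" and k_le: "\<And>g. k g \<le> B" and K: "compact K" "\<And>g. g \<notin> K \<Longrightarrow> k g = 0"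
    and fib: "\<And>g. fiber (\<lambda>g. ennreal (k g)) g \<le> 1" "\<And>g. proj g \<in> L \<Longrightarrow> fiber (\<lambda>g. ennreal (k g)) g = 1"
    by (rule fiber_cutoff[OF L]) (rule that; assumption)
  have [measurable]: "f \<in> borel_measurable mQ"
    by (rule Cc_measurable[OF f])
  \<comment> \<open>The coset integral of \<psi> is f at every coset: where f is nonzero the weight
    k integrates to 1, elsewhere the constant factor f vanishes. So the sums over hitting times
    agree for every x.\<close>
  define \<psi> where "\<psi> g = k g *\<^sub>R f (proj g)" for g
  have "(LINT x|completion \<mu>. transverse_sum G H act Y (at_coset (\<lambda>g. LINT h|mH. \<psi> (h \<otimes> g))) x * \<phi> x)
      = (LINT g|mG. \<psi> g * dual \<phi> g)"
  proof (rule transverse_identity[OF _ _ K(1) _ \<phi> C])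
    show "\<psi> \<in> borel_measurable borel"
      unfolding \<psi>_def[abs_def] by measurable
    show "norm (\<psi> g) \<le> B * M" for g
      unfolding \<psi>_def using k_nonneg[of g] k_le[of g] M(2)[of "proj g"] by (auto intro!: mult_mono)
    show "\<psi> g = 0" if "g \<notin> K" for g
      using K(2)[OF that] by (simp add: \<psi>_def)
  qed
  moreover have "transverse_sum G H act Y (at_coset (\<lambda>g. LINT h|mH. \<psi> (h \<otimes> g))) x = transverse_sum G H act Y f x" for x
    unfolding transverse_sum_def
  proof (rule infsum_cong)
    fix c assume "c \<in> hit x"
    have int1: "(LINT h|mH. \<psi> (h \<otimes> g)) = f (proj g)" for g
    proof -
      have "(LINT h|mH. \<psi> (h \<otimes> g)) = (LINT h|mH. k (h \<otimes> g) *\<^sub>R f (proj g))"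
        unfolding \<psi>_def by (intro Bochner_Integration.integral_cong) auto
      also have "\<dots> = f (proj g)"
      proof (cases "f (proj g) = 0")
        case False
        then have 1: "(\<integral>\<^sup>+h. ennreal (k (h \<otimes> g)) \<partial>mH) = 1"
          using fib(2)[OF supp] by (simp add: fiber_def)
        have m: "(\<lambda>h. k (h \<otimes> g)) \<in> borel_measurable mH"
          by (rule measurable_mH) measurable
        have "integrable mH (\<lambda>h. k (h \<otimes> g))"
          using m k_nonneg 1 by (intro integrableI_nonneg) auto
        moreover have "(LINT h|mH. k (h \<otimes> g)) = 1"
          using m k_nonneg 1 by (subst integral_eq_nn_integral) auto
        ultimately show ?thesis
          by simp
      qed simp
      finally show ?thesis .
    qed
    obtain g where c: "c = proj g"
      using \<open>c \<in> hit x\<close> hit_subset by blast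
    show "at_coset (\<lambda>g. LINT h|mH. \<psi> (h \<otimes> g)) c = f c"
      unfolding int1 c by (rule at_coset_proj) simp
  qed
  moreover have "(LINT g|mG. \<psi> g * dual \<phi> g) = (LINT g|mG. k g *\<^sub>R (f (proj g) * at_coset (dual \<phi>) (proj g)))"
    by (simp add: \<psi>_def at_coset_dual)
  moreover have "\<dots> = (LINT c|mQ. f c * at_coset (dual \<phi>) c)"
  proof (rule weil_integral[of k "\<lambda>c. f c * at_coset (dual \<phi>) c"])
    show "(\<lambda>c. f c * at_coset (dual \<phi>) c) \<in> borel_measurable mQ"
      using at_coset_dual_measurable[OF \<phi>] by measurable
    show "fiber (\<lambda>g. ennreal (k g)) g = 1" if "f (proj g) * at_coset (dual \<phi>) (proj g) \<noteq> 0" for g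
      using that by (intro fib(2) supp) auto
  qed (use k_nonneg fib in auto)
  ultimately show ?thesis
    by simp
qed

text \<open>The bilinear identity is applied to the conjugate of a bounded Borel representative,
  conjugation commuting with the integral over \<sigma>. The representative is exchanged for \<phi>
  on both sides by almost everywhere equality, for \<mu> and for the quotient measure.\<close>

lemma adjoint:
  assumes f: "f \<in> Cc T" and \<phi>: "\<phi> \<in> Linf_space \<mu>"
  shows "(LINT x|completion \<mu>. transverse_sum G H act Y f x * cnj (\<phi> x))
    = (LINT c|completion mQ. f c * cnj (transverse_dual G act \<sigma> \<phi> c))"
proof -
  obtain \<phi>' C where \<phi>'[measurable]: "\<phi>' \<in> borel_measurable X" and C: "\<And>x. norm (\<phi>' x) \<le> C"
    and ae: "AE x in \<mu>. \<phi> x = \<phi>' x"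
    using Linf_representative[OF \<phi>] by blast
  have cnj_meas: "(\<lambda>x. cnj (\<phi>' x)) \<in> borel_measurable X"
    by (rule measurable_compose[OF \<phi>' measurable_cnj])
  have \<phi>'_c: "\<phi>' \<in> borel_measurable (completion \<mu>)"
    using \<phi>' by (intro measurable_completion) (simp cong: measurable_cong_sets)
  have \<phi>_c: "\<phi> \<in> borel_measurable (completion \<mu>)"
    using \<phi> by (simp add: Linf_space_def)
  have S_c: "transverse_sum G H act Y f \<in> borel_measurable (completion \<mu>)"
    using transverse_sum_Cc(2)[OF f] by auto
  have d_meas [measurable]: "at_coset (dual \<phi>') \<in> borel_measurable mQ"
    by (rule at_coset_dual_measurable[OF \<phi>'])
  have d_ae: "AE c in mQ. at_coset (dual \<phi>') c = transverse_dual G act \<sigma> \<phi> c"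
    using Linf_dual(2)[OF \<phi>' C ae] by eventually_elim simp
  have f_meas [measurable]: "f \<in> borel_measurable mQ"
    by (rule Cc_measurable[OF f])
  have "(LINT x|completion \<mu>. transverse_sum G H act Y f x * cnj (\<phi> x))
      = (LINT x|completion \<mu>. transverse_sum G H act Y f x * cnj (\<phi>' x))"
  proof (rule integral_cong_AE)
    show "AE x in completion \<mu>. transverse_sum G H act Y f x * cnj (\<phi> x) = transverse_sum G H act Y f x * cnj (\<phi>' x)"
      using AE_completion[OF ae] by eventually_elim simp
  qed (use S_c \<phi>_c \<phi>'_c in measurable)
  also have "\<dots> = (LINT c|mQ. f c * at_coset (dual (\<lambda>x. cnj (\<phi>' x))) c)"
    using C by (intro adjoint_bounded[OF f cnj_meas, of C]) simp
  also have "\<dots> = (LINT c|mQ. f c * cnj (at_coset (dual \<phi>') c))"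
    by (simp add: dual_def at_coset_def)
  also have "\<dots> = (LINT c|completion mQ. f c * cnj (at_coset (dual \<phi>') c))"
    using f_meas d_meas by (intro integral_completion[symmetric]) measurable
  also have "\<dots> = (LINT c|completion mQ. f c * cnj (transverse_dual G act \<sigma> \<phi> c))"
  proof (rule integral_cong_AE)
    have "transverse_dual G act \<sigma> \<phi> \<in> borel_measurable (completion mQ)"
      by (rule measurable_completion_AE[OF measurable_completion[OF d_meas] d_ae]) simp
    then show "(\<lambda>c. f c * cnj (transverse_dual G act \<sigma> \<phi> c)) \<in> borel_measurable (completion mQ)"
      using measurable_completion[OF f_meas] by measurable
    show "(\<lambda>c. f c * cnj (at_coset (dual \<phi>') c)) \<in> borel_measurable (completion mQ)"
      using measurable_completion[OF f_meas] measurable_completion[OF d_meas] by measurable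
    show "AE c in completion mQ. f c * cnj (at_coset (dual \<phi>') c) = f c * cnj (transverse_dual G act \<sigma> \<phi> c)"
      using AE_completion[OF d_ae] by eventually_elim simp
  qed
  finally show ?thesis .
qed

section \<open>The two linear operators\<close>

text \<open>Members of \<open>Cc T\<close> are functions on all sets of group elements but are
  constrained only on cosets, so equality on cosets is the proper identification; the hitting times
  are cosets. Additivity is deduced from convergence of both sums, hence only almost
  everywhere.\<close>

lemma transverse_sum_operator:
  "linear_operator_mod (Cc T) (eq_on (rcosets H)) (L1_space \<mu>) (ae_eq \<mu>) (transverse_sum G H act Y)"
  unfolding linear_operator_mod_def
proof (intro conjI ballI allI impI)
  fix f assume f: "f \<in> Cc T"
  show "transverse_sum G H act Y f \<in> L1_space \<mu>"
    using transverse_sum_Cc(2)[OF f] by (simp add: L1_space_def)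
  show "ae_eq \<mu> (transverse_sum G H act Y (\<lambda>c. a * f c)) (\<lambda>x. a * transverse_sum G H act Y f x)" for a
    by (simp add: ae_eq_def transverse_sum_def infsum_cmult_right')
  fix g assume g: "g \<in> Cc T"
  show "ae_eq \<mu> (transverse_sum G H act Y (\<lambda>c. f c + g c)) (\<lambda>x. transverse_sum G H act Y f x + transverse_sum G H act Y g x)"
    unfolding ae_eq_def using transverse_sum_Cc(1)[OF f] transverse_sum_Cc(1)[OF g]
    by eventually_elim (simp add: transverse_sum_def infsum_add)
  assume "eq_on (rcosets H) f g"
  then have "transverse_sum G H act Y f x = transverse_sum G H act Y g x" for x
    unfolding transverse_sum_def using hit_subset[of x]
    by (intro infsum_cong) (auto simp: eq_on_def rcosets_eq)
  then show "ae_eq \<mu> (transverse_sum G H act Y f) (transverse_sum G H act Y g)"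
    by (simp add: ae_eq_def)
qed

lemma transverse_dual_integrable:
  assumes "\<phi> \<in> Linf_space \<mu>"
  shows "AE c in mQ. \<forall>g\<in>c. integrable (completion \<sigma>) (\<lambda>y. \<phi> (act (inv g) y))"
proof -
  obtain \<phi>' C where "\<phi>' \<in> borel_measurable X" "\<And>x. norm (\<phi>' x) \<le> C" "AE x in \<mu>. \<phi> x = \<phi>' x"
    using Linf_representative[OF assms] by blast
  then show ?thesis
    by (rule Linf_dual(1))
qed

text \<open>Equivalent functions share one bounded Borel representative, so their duals agree almost
  everywhere with the same function. Additivity uses integrability of both translates, which holds
  at almost every coset.\<close>

lemma transverse_dual_operator:
  "linear_operator_mod (Linf_space \<mu>) (ae_eq \<mu>) (Linf_space mQ) (ae_eq mQ) (transverse_dual G act \<sigma>)"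
  unfolding linear_operator_mod_def
proof (intro conjI ballI allI impI)
  fix \<phi> assume \<phi>: "\<phi> \<in> Linf_space \<mu>"
  obtain \<phi>' C where \<phi>'[measurable]: "\<phi>' \<in> borel_measurable X" and C: "\<And>x. norm (\<phi>' x) \<le> C"
    and ae: "AE x in \<mu>. \<phi> x = \<phi>' x"
    using Linf_representative[OF \<phi>] by blast
  have d_ae: "AE c in mQ. at_coset (dual \<phi>') c = transverse_dual G act \<sigma> \<phi> c"
    using Linf_dual(2)[OF \<phi>' C ae] by eventually_elim simp
  have "transverse_dual G act \<sigma> \<phi> \<in> borel_measurable (completion mQ)"
    by (rule measurable_completion_AE[OF measurable_completion[OF at_coset_dual_measurable[OF \<phi>']] d_ae]) simp
  moreover have "AE c in mQ. norm (transverse_dual G act \<sigma> \<phi> c) \<le> C * measure \<sigma> Y"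
    using d_ae
  proof (rule AE_mp, intro AE_I2 impI)
    fix c assume "c \<in> space mQ" "at_coset (dual \<phi>') c = transverse_dual G act \<sigma> \<phi> c"
    then show "norm (transverse_dual G act \<sigma> \<phi> c) \<le> C * measure \<sigma> Y"
      using dual_bounded(2)[OF \<phi>' C] by (metis at_coset_def)
  qed
  ultimately show "transverse_dual G act \<sigma> \<phi> \<in> Linf_space mQ"
    by (auto simp: Linf_space_def)
  show "ae_eq mQ (transverse_dual G act \<sigma> (\<lambda>x. a * \<phi> x)) (\<lambda>c. a * transverse_dual G act \<sigma> \<phi> c)" for a
    by (simp add: ae_eq_def transverse_dual_def at_coset_def)
  fix \<theta> assume \<theta>: "\<theta> \<in> Linf_space \<mu>"
  \<comment> \<open>Integrability is known for all g in c, while \<open>at_coset\<close> evaluates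
    at a chosen element, which must therefore be seen to lie in c.\<close>
  have rep: "AE c in mQ. (SOME g. g \<in> c) \<in> c"
    by (intro AE_I2) (metis imageE mem_proj_iff someI space_mQ)
  show "ae_eq mQ (transverse_dual G act \<sigma> (\<lambda>x. \<phi> x + \<theta> x))
      (\<lambda>c. transverse_dual G act \<sigma> \<phi> c + transverse_dual G act \<sigma> \<theta> c)"
    unfolding ae_eq_def using transverse_dual_integrable[OF \<phi>] transverse_dual_integrable[OF \<theta>] rep
    by eventually_elim (simp add: transverse_dual_def at_coset_def)
  assume "ae_eq \<mu> \<phi> \<theta>"
  with ae have "AE x in \<mu>. \<theta> x = \<phi>' x"
    unfolding ae_eq_def by eventually_elim simp
  from Linf_dual(2)[OF \<phi>' C this] d_ae
  show "ae_eq mQ (transverse_dual G act \<sigma> \<phi>) (transverse_dual G act \<sigma> \<theta>)"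
    unfolding ae_eq_def by eventually_elim simp
qed

end

theorem theorem2:
  fixes G :: "('g::{t2_space, second_countable_topology}, 'b) monoid_scheme"
    and H :: "'g set"
    and mG mH :: "'g measure" and mQ :: "'g set measure"
    and X \<mu> \<sigma> :: "'x measure" and act :: "'g \<Rightarrow> 'x \<Rightarrow> 'x" and Y :: "'x set"
  assumes "lcsc_group G" and "unimodular G"
    and "subgroup H G" and "closed H" and "unimodular (G\<lparr>carrier := H\<rparr>)"
    and "left_haar_measure G mG" and "left_haar_measure (G\<lparr>carrier := H\<rparr>) mH"
    and "quotient_measure G H mG mH mQ"
    and "integrable_transverse_system G H X act Y \<mu>"
    and "transverse_measure G H mG mH X act Y \<mu> \<sigma>"
  shows
    "(\<forall>f\<in>Cc (coset_topology G H). AE x in \<mu>. f summable_on hitting_times G H act Y x) \<and>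
     linear_operator_mod
       (Cc (coset_topology G H)) (eq_on (rcosets\<^bsub>G\<^esub> H)) (L1_space \<mu>) (ae_eq \<mu>)
       (transverse_sum G H act Y) \<and>
     (\<forall>\<phi>\<in>Linf_space \<mu>.
        (AE c in mQ. \<forall>g\<in>c. integrable (completion \<sigma>) (\<lambda>y. \<phi> (act (inv\<^bsub>G\<^esub> g) y))) \<and>
        (\<forall>g\<in>carrier G.
           transverse_dual G act \<sigma> \<phi> (H #>\<^bsub>G\<^esub> g) =
             (LINT y|completion \<sigma>. \<phi> (act (inv\<^bsub>G\<^esub> g) y)))) \<and>
     linear_operator_mod (Linf_space \<mu>) (ae_eq \<mu>) (Linf_space mQ) (ae_eq mQ)
       (transverse_dual G act \<sigma>) \<and>
     (\<forall>f\<in>Cc (coset_topology G H). \<forall>\<phi>\<in>Linf_space \<mu>.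
        (LINT x|completion \<mu>. transverse_sum G H act Y f x * cnj (\<phi> x)) =
        (LINT c|completion mQ. f c * cnj (transverse_dual G act \<sigma> \<phi> c)))"
proof -
  interpret integrable_transverse G mG H mH mQ X \<mu> \<sigma> act Y
    using assms by (intro integrable_transverse.intro homogeneous_pair.intro unimodular_haar.intro
      unimodular_haar_axioms.intro homogeneous_pair_axioms.intro integrable_transverse_axioms.intro)
  show ?thesis
    using transverse_sum_Cc(1) transverse_sum_operator transverse_dual_integrable transverse_dual_proj
      transverse_dual_operator adjoint by blast
qed

end
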